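(* Assume (A1), (A2) and (A3). There exists $\xi_0>0$ such that for every $\xi\ge\xi_0$ and every $\gamma\in(0,1)$ the following holds. For every local minimum $\hat z$ of $\min_{z\in\mathcal E\cap\mathcal Z}\tfrac12z^\top Hz+h^\top z$ with $F_\xi(\hat z)\ne\varnothing$, and for all $\hat s\in F_\xi(\hat z)$ except a subset of measure zero, there is $\epsilon>0$ such that for every initial iterate $s_0$ with $\|s_0-\hat s\|\le\epsilon$ the Algorithm started at $s_0$ converges to a fixed point $(z^*,y^*,s^* )$. Whenever it converges, $z_j$ and $y_j$ converge to each other, i.e. $z^*=y^*$, and to a local minimum of the problem, and $s_j$ converges to a fixed point of $T_\xi$, i.e. $s^*\in T_\xi(s^* )$.
   Context: Setting: $H\in\mathbb R^{n\times n}$ is (symmetric) positive definite, $h\in\mathbb R^n$. The set $\mathcal Z=\prod_{k=1}^N\big(\bigcup_{i=1}^{m_k}\mathcal Z_{k,i}\big)\subseteq\mathbb R^n$, where $n=\sum_k n_k$ and each $\mathcal Z_{k,i}\subseteq\mathbb R^{n_k}$ is a closed convex polyhedron. The set $\mathcal E=\{z\in\mathbb R^n: Az=b\}=\{Vv+\bar v: v\in\mathbb R^{n-m}\}$, with $A\in\mathbb R^{m\times n}$ of full row rank, $V\in\mathbb R^{n\times(n-m)}$ of full column rank, $\bar v\in\mathbb R^n$. It is assumed that $\mathcal E\cap\mathcal Z\neq\varnothing$. A local minimum is a point of $\mathcal E\cap\mathcal Z$ minimizing the objective over the intersection of $\mathcal E\cap\mathcal Z$ with some closed ball of positive radius around it.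 Projection: $\Pi_{\mathcal Z}(s)=\operatorname{argmin}_{z\in\mathcal Z}\|s-z\|$ (set-valued). Regular normal cone of a closed set $\mathcal C$ at $z\in\mathcal C$: $\hat N_{\mathcal C}(z)=\{x:\limsup_{u\to z,\,u\in\mathcal C,\,u\ne z}\langle x,u-z\rangle/\|u-z\|\le0\}$ (empty if $z\notin\mathcal C$). Regular KKT point: $(z,\lambda)$ with $0\in\{Hz+h\}+\hat N_{\mathcal E}(z)-\{\lambda\}$ and $0\in\hat N_{\mathcal Z}(z)+\{\lambda\}$. For $\xi>0$, a $\xi$-proximal KKT point is $(z,\lambda)$ with $0\in\{Hz+h\}+\hat N_{\mathcal E}(z)-\{\lambda\}$ and $z\in\Pi_{\mathcal Z}(z-\tfrac1\xi\lambda)$. Define $F_\xi(z)=\{s\in\mathbb R^n:(z,\xi(z-s))\text{ is a }\xi\text{-proximal KKT point}\}$ (a convex set; the fixed points of $T_\xi$ corresponding to $z$). Matrices: $R=V(V^\top HV)^{-1}V^\top$; $\lambda^+_{\min}(R)$ is its smallest non-zero eigenvalue; $M_\xi=\xi(\xi R-I)^{-1}R$; $c_\xi=(\xi R-I)^{-1}(R(h+H\bar v)-\bar v)$. For $\xi>1/\lambda^+_{\min}(R)$ (always assumed when these objects are used) write $M_\xi=Q\,\mathrm{diag}(\Lambda,0)\,Q^\top$ with $Q$ orthonormal, $\Lambda\in\mathbb R^{(n-m)\times(n-m)}$ diagonal positive definite, and set $W=Q\,\mathrm{diag}(\tfrac12\Lambda^{-1},-I)\,Q^\top$. Operator: $T_\xi(s)=\{s-W(M_\xi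 s+c_\xi-y):y\in\Pi_{\mathcal Z}(s)\}$. Algorithm (input $s_0\in\mathbb R^n$, $\gamma\in(0,1)$): Step 1: if $z^\circ:=\bar v-R(h+H\bar v)\in\mathcal Z$, return $z^\circ$ (this counts as convergence to $(z^\circ,z^\circ,z^\circ)$). Otherwise, for $j=0,1,\dots$: $z_{j+1}=M_\xi s_j+c_\xi$; $y_{j+1}\in\Pi_{\mathcal Z}(s_j)$ (any choice); $s_{j+1}=s_j-\gamma W(z_{j+1}-y_{j+1})$. Convergence refers to the infinite sequence of iterates (no stopping tolerance). A fixed point of the Algorithm is a triple $(z,y,s)$ with $z=M_\xi s+c_\xi$, $y\in\Pi_{\mathcal Z}(s)$, $s=s-\gamma W(z-y)$. Assumptions. (A1) There is at least one regular KKT point. (A2) For any local minimum $z^*$ such that $F_{\bar\xi}(z^* )\ne\varnothing$ and $z^*\notin F_{\bar\xi}(z^* )$ for some $\bar\xi>0$, there exist $\xi\ge\bar\xi$ and $s^*\in F_\xi(z^* )$ such that $\lambda^*:=\xi(z^*-s^* )$ satisfies $-\lambda^*\in\operatorname{relint}\hat N_{\mathcal Z}(z^* )$. (A3) For any $z\in\mathcal Z$, either $\hat N_{\mathcal Z}(z)=\{0\}$, or there is $\epsilon>0$ such that $z+w\in\mathcal Z$ for all $w\in\hat N_{\mathcal Z}(z)^\perp$ with $\|w\|\le\epsilon$. Measure zero for a subset of the convex set $F_\xi(\hat z)$ means zero Lebesgue measure on the affine hull of $F_\xi(\hat z)$. *)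

theory Defs
  imports "HOL-Analysis.Analysis"
begin

section \<open>Problem data\<close>

definition positive_definite :: "real^'n^'n \<Rightarrow> bool" where
  "positive_definite H \<longleftrightarrow> transpose H = H \<and> (\<forall>x. x \<noteq> 0 \<longrightarrow> 0 < x \<bullet> (H *v x))"

definition quad_objective :: "real^'n^'n \<Rightarrow> real^'n \<Rightarrow> real^'n \<Rightarrow> real" where
  "quad_objective H h z = 1/2 * (z \<bullet> (H *v z)) + h \<bullet> z"

definition local_minimum :: "('a::metric_space \<Rightarrow> real) \<Rightarrow> 'a set \<Rightarrow> 'a \<Rightarrow> bool" where
  "local_minimum f S z \<longleftrightarrow> z \<in> S \<and> (\<exists>r>0. \<forall>u \<in> S \<inter> cball z r. f z \<le> f u)"

text \<open>The \<open>N\<close> factors of \<open>\<real>\<^sup>n = \<Prod>\<^sub>k \<real>\<^bsup>n\<^sub>k\<^esup>\<close> are described by a map \<open>blk\<close> that sends each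
  coordinate to the number of its block, so that \<open>n\<^sub>k\<close> is the number of coordinates in block
  \<open>k\<close>.  The space \<open>\<real>\<^bsup>n\<^sub>k\<^esup>\<close> is identified with the coordinate subspace \<open>block_space blk k\<close>,
  and \<open>block_part blk k\<close> is the projection onto the \<open>k\<close>-th factor.\<close>

definition block_space :: "('n \<Rightarrow> nat) \<Rightarrow> nat \<Rightarrow> (real^'n) set" where
  "block_space blk k = {x. \<forall>j. blk j \<noteq> k \<longrightarrow> x $ j = 0}"

definition block_part :: "('n \<Rightarrow> nat) \<Rightarrow> nat \<Rightarrow> real^'n \<Rightarrow> real^'n" where
  "block_part blk k z = (\<chi> j. if blk j = k then z $ j else 0)"

definition product_of_unions ::
    "('n \<Rightarrow> nat) \<Rightarrow> nat \<Rightarrow> (nat \<Rightarrow> nat) \<Rightarrow> (nat \<Rightarrow> nat \<Rightarrow> (real^'n) set) \<Rightarrow> (real^'n) set" where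
  "product_of_unions blk N mk Zc =
     {z. \<forall>k\<in>{1..N}. block_part blk k z \<in> (\<Union>i\<in>{1..mk k}. Zc k i)}"

section \<open>Projection, normal cone and KKT points\<close>

definition proj_set :: "'a::real_normed_vector set \<Rightarrow> 'a \<Rightarrow> 'a set" where
  "proj_set Z s = {z. is_arg_min (\<lambda>z. norm (s - z)) (\<lambda>z. z \<in> Z) z}"

text \<open>At an isolated point of \<open>C\<close> the filter is trivial, the limsup is \<open>-\<infinity>\<close>, and the cone is
  the whole space.\<close>

definition regular_normal_cone :: "'a::euclidean_space set \<Rightarrow> 'a \<Rightarrow> 'a set" where
  "regular_normal_cone C z =
     (if z \<in> C
      then {x. Limsup (at z within C) (\<lambda>u. ereal (x \<bullet> (u - z) / norm (u - z))) \<le> 0}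
      else {})"

definition regular_KKT_point ::
    "real^'n^'n \<Rightarrow> real^'n \<Rightarrow> (real^'n) set \<Rightarrow> (real^'n) set \<Rightarrow> real^'n \<Rightarrow> real^'n \<Rightarrow> bool" where
  "regular_KKT_point H h E Z z l \<longleftrightarrow>
     (\<exists>\<nu>\<in>regular_normal_cone E z. 0 = H *v z + h + \<nu> - l) \<and>
     (\<exists>\<mu>\<in>regular_normal_cone Z z. 0 = \<mu> + l)"

definition proximal_KKT_point ::
    "real^'n^'n \<Rightarrow> real^'n \<Rightarrow> (real^'n) set \<Rightarrow> (real^'n) set \<Rightarrow> real \<Rightarrow> real^'n \<Rightarrow> real^'n \<Rightarrow> bool"
  where
  "proximal_KKT_point H h E Z \<xi> z l \<longleftrightarrow>
     (\<exists>\<nu>\<in>regular_normal_cone E z. 0 = H *v z + h + \<nu> - l) \<and>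
     z \<in> proj_set Z (z - (1/\<xi>) *\<^sub>R l)"

definition F_set ::
    "real^'n^'n \<Rightarrow> real^'n \<Rightarrow> (real^'n) set \<Rightarrow> (real^'n) set \<Rightarrow> real \<Rightarrow> real^'n \<Rightarrow> (real^'n) set" where
  "F_set H h E Z \<xi> z = {s. proximal_KKT_point H h E Z \<xi> z (\<xi> *\<^sub>R (z - s))}"

section \<open>The matrices\<close>

definition R_mat :: "real^'n^'n \<Rightarrow> real^'d^'n \<Rightarrow> real^'n^'n" where
  "R_mat H V = V ** matrix_inv (transpose V ** H ** V) ** transpose V"

definition min_nonzero_eigenvalue :: "real^'n^'n \<Rightarrow> real" where
  "min_nonzero_eigenvalue A = Min {r. r \<noteq> 0 \<and> (\<exists>x. x \<noteq> 0 \<and> A *v x = r *\<^sub>R x)}"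

definition M_mat :: "real^'n^'n \<Rightarrow> real^'d^'n \<Rightarrow> real \<Rightarrow> real^'n^'n" where
  "M_mat H V \<xi> = \<xi> *\<^sub>R (matrix_inv (\<xi> *\<^sub>R R_mat H V - mat 1) ** R_mat H V)"

definition c_vec ::
    "real^'n^'n \<Rightarrow> real^'n \<Rightarrow> real^'d^'n \<Rightarrow> real^'n \<Rightarrow> real \<Rightarrow> real^'n" where
  "c_vec H h V vbar \<xi> =
     matrix_inv (\<xi> *\<^sub>R R_mat H V - mat 1) *v (R_mat H V *v (h + H *v vbar) - vbar)"

definition diag_mat :: "('i \<Rightarrow> real) \<Rightarrow> real^'i^'i" where
  "diag_mat d = (\<chi> i j. if i = j then d i else 0)"

text \<open>In the decomposition \<open>M = Q diag(\<Lambda>, 0) Q\<^sup>T\<close> the columns of \<open>Q\<close> are indexed by the sum of a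
  type \<open>'d\<close> with \<open>n - m\<close> elements and a type \<open>'m\<close> with \<open>m\<close> elements, one for each diagonal
  block; \<open>\<Lambda>\<close> is given by its diagonal entries.\<close>

definition spectral_decomposition ::
    "real^'n^'n \<Rightarrow> real^('d::finite + 'm::finite)^'n \<Rightarrow> real^'d \<Rightarrow> bool" where
  "spectral_decomposition M Q \<Lambda> \<longleftrightarrow>
     transpose Q ** Q = mat 1 \<and> Q ** transpose Q = mat 1 \<and> (\<forall>i. 0 < \<Lambda> $ i) \<and>
     M = Q ** diag_mat (case_sum (\<lambda>i. \<Lambda> $ i) (\<lambda>_. 0)) ** transpose Q"

definition W_mat :: "real^('d::finite + 'm::finite)^'n \<Rightarrow> real^'d \<Rightarrow> real^'n^'n" where
  "W_mat Q \<Lambda> = Q ** diag_mat (case_sum (\<lambda>i. 1/2 * inverse (\<Lambda> $ i)) (\<lambda>_. - 1)) ** transpose Q"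

section \<open>Operator and algorithm\<close>

text \<open>Below, \<open>M\<close>, \<open>c\<close> and \<open>W\<close> stand for \<open>M\<^sub>\<xi>\<close>, \<open>c\<^sub>\<xi>\<close> and \<open>W\<close>.\<close>

definition T_op ::
    "(real^'n) set \<Rightarrow> real^'n^'n \<Rightarrow> real^'n \<Rightarrow> real^'n^'n \<Rightarrow> real^'n \<Rightarrow> (real^'n) set" where
  "T_op Z M c W s = {s - W *v (M *v s + c - y) | y. y \<in> proj_set Z s}"

definition z_circ :: "real^'n^'n \<Rightarrow> real^'n \<Rightarrow> real^'d^'n \<Rightarrow> real^'n \<Rightarrow> real^'n" where
  "z_circ H h V vbar = vbar - R_mat H V *v (h + H *v vbar)"

text \<open>\<open>algorithm_run Z zo M c W \<gamma> s0 z y s\<close>: the sequences \<open>z\<close>, \<open>y\<close>, \<open>s\<close> result from some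
  execution started at \<open>s0\<close>, where \<open>zo\<close> is the candidate tested in Step 1.  Returning \<open>zo\<close> is
  encoded by constant sequences, because it counts as convergence to \<open>(zo, zo, zo)\<close>.  The
  entries \<open>z 0\<close> and \<open>y 0\<close> are otherwise meaningless and left arbitrary.\<close>

definition algorithm_run ::
    "(real^'n) set \<Rightarrow> real^'n \<Rightarrow> real^'n^'n \<Rightarrow> real^'n \<Rightarrow> real^'n^'n \<Rightarrow> real \<Rightarrow> real^'n \<Rightarrow>
     (nat \<Rightarrow> real^'n) \<Rightarrow> (nat \<Rightarrow> real^'n) \<Rightarrow> (nat \<Rightarrow> real^'n) \<Rightarrow> bool" where
  "algorithm_run Z zo M c W \<gamma> s0 z y s \<longleftrightarrow>
     (if zo \<in> Z then z = (\<lambda>_. zo) \<and> y = (\<lambda>_. zo) \<and> s = (\<lambda>_. zo)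
      else s 0 = s0 \<and>
        (\<forall>j. z (Suc j) = M *v s j + c \<and>
             y (Suc j) \<in> proj_set Z (s j) \<and>
             s (Suc j) = s j - \<gamma> *\<^sub>R (W *v (z (Suc j) - y (Suc j)))))"

definition algorithm_fixed_point ::
    "(real^'n) set \<Rightarrow> real^'n^'n \<Rightarrow> real^'n \<Rightarrow> real^'n^'n \<Rightarrow> real \<Rightarrow>
     real^'n \<Rightarrow> real^'n \<Rightarrow> real^'n \<Rightarrow> bool" where
  "algorithm_fixed_point Z M c W \<gamma> z y s \<longleftrightarrow>
     z = M *v s + c \<and> y \<in> proj_set Z s \<and> s = s - \<gamma> *\<^sub>R (W *v (z - y))"

section \<open>Lebesgue measure on an affine set\<close>

text \<open>As for \<^const>\<open>lborel\<close>, the measure is the image of a product of one-dimensional Lebesgue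
  measures, here under the isometric parametrization of the nonempty affine set \<open>L\<close> given by a
  base point and an orthonormal basis of the direction space.  It does not depend on these two
  choices.  If \<open>L\<close> is a single point, it is the unit mass at that point.\<close>

definition affine_lebesgue :: "'a::euclidean_space set \<Rightarrow> 'a measure" where
  "affine_lebesgue L =
     (let a = (SOME a. a \<in> L);
          B = (SOME B. pairwise orthogonal B \<and> (\<forall>b\<in>B. norm b = 1) \<and>
                 span B = {x - y | x y. x \<in> L \<and> y \<in> L})
      in completion (distr (\<Pi>\<^sub>M b\<in>B. lborel) borel (\<lambda>f. a + (\<Sum>b\<in>B. f b *\<^sub>R b))))"

end

theory Submission
  imports Defs
begin

text \<open>
  The set \<open>Z\<close> is a finite union of polyhedra \<open>\<P>\<close> (\<open>product_of_unions_eq_Union_polyhedra\<close>), and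
  \<open>M *v s + c = z\<close> says that \<open>z\<close> minimises the objective minus the linear term \<open>\<lambda> \<bullet> z\<close> over \<open>E\<close>,
  where \<open>\<lambda> = \<xi> *\<^sub>R (z - s)\<close> (\<open>M_c_eq_iff_stationary\<close>).  The matrix \<open>W\<close> is invertible, so in a limit
  \<open>(z, y, s)\<close> of the algorithm \<open>z = y\<close> is the projection of \<open>s\<close>.  Then \<open>-\<lambda>\<close> is normal to every
  polyhedron through \<open>z\<close>, the first-order change of the objective is nonnegative in all feasible
  directions, and convexity makes \<open>z\<close> a local minimum
  (\<open>stationary_projection_imp_local_minimum\<close>).

  For the convergence, suppose that \<open>z_circ\<close> is infeasible, as the algorithm stops immediately
  otherwise.  Let \<open>zh\<close> be a local minimum and \<open>sh\<close> a relative interior point of its convex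
  set of fixed points \<open>F\<close>; the rest of \<open>F\<close> is a null set, because disjoint homothetic copies of the
  relative frontier fit into a ball (\<open>convex_rel_frontier_null\<close>).  The relative interior assumption
  provides a fixed point for some smaller \<open>\<xi>'\<close>, which can be rescaled to \<open>\<xi>\<close>
  (\<open>F_set_rescale\<close>).  Prolonging the segment from this point to \<open>sh\<close> within \<open>F\<close> shows that \<open>sh\<close> is
  non-degenerate: \<open>zh\<close> is its only nearest point in \<open>Z\<close>, and \<open>sh - zh\<close> is orthogonal only to those
  directions of \<open>Z\<close> that are orthogonal to the whole normal cone
  (\<open>rel_interior_F_set_nondegenerate\<close>).  These directions form a linear space \<open>L\<close> that \<open>Z\<close>
  contains locally.  As the pieces are polyhedral, \<open>(sh - zh) \<bullet> u\<close> decreases linearly in the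
  distance of \<open>u\<close> from \<open>L\<close>, and therefore the projection onto \<open>Z\<close> is \<open>zh + P (s - sh)\<close> near \<open>sh\<close>,
  where \<open>P\<close> is the orthogonal projection onto \<open>L\<close> (\<open>proj_set_locally_affine\<close>).

  So the error \<open>e = s - sh\<close> obeys the linear recursion with \<open>e - \<gamma> *\<^sub>R (W *v (M *v e - P e))\<close> as
  long as it is small.  In the inner product with weights \<open>2 * \<Lambda>\<close> and \<open>1\<close> on the two blocks the
  undamped step is nonexpansive (\<open>linear_step_averaged\<close>); this follows from \<open>\<Lambda> \<ge> 1\<close> and an
  inequality between two orthogonal projections (\<open>two_projections_inequality\<close>).  Hence the error
  stays small, and the damped iteration converges by the Krasnoselskii-Mann argument
  (\<open>linear_Krasnoselskii_Mann\<close>).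

  The threshold for \<open>\<xi>\<close> can be chosen uniformly, because strict convexity leaves at most one local
  minimum per polyhedron (\<open>finite_local_minima\<close>).
\<close>

(* Rewriting transpose Q *v x to x v* Q would hide the products of Q with its transpose. *)
declare transpose_matrix_vector [simp del]

section \<open>Projections and regular normals\<close>

lemma proj_set_iff:
  "y \<in> proj_set Z s \<longleftrightarrow> y \<in> Z \<and> (\<forall>u\<in>Z. norm (s - y) \<le> norm (s - u))"
  by (auto simp: proj_set_def is_arg_min_linorder)

lemma proj_set_iff_inner:
  fixes s y :: "'a::euclidean_space"
  shows "y \<in> proj_set Z s \<longleftrightarrow>
    y \<in> Z \<and> (\<forall>u\<in>Z. 2 * ((s - y) \<bullet> (u - y)) \<le> (u - y) \<bullet> (u - y))"
proof -
  have "norm (s - y) \<le> norm (s - u) \<longleftrightarrow> 2 * ((s - y) \<bullet> (u - y)) \<le> (u - y) \<bullet> (u - y)" for u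
    unfolding norm_le by (simp add: inner_diff inner_commute algebra_simps)
  then show ?thesis by (simp add: proj_set_iff)
qed

text \<open>A bound of second order in \<open>u - z\<close> makes the quotients of the limsup at most of order
  \<open>norm (u - z)\<close>.\<close>

lemma proximal_in_regular_normal_cone:
  fixes z :: "'a::euclidean_space"
  assumes "z \<in> C" and prox: "\<And>u. u \<in> C \<Longrightarrow> x \<bullet> (u - z) \<le> K * ((u - z) \<bullet> (u - z))"
  shows "x \<in> regular_normal_cone C z"
proof -
  have "((\<lambda>u. K * norm (u - z)) \<longlongrightarrow> K * norm (z - z)) (at z within C)"
    by (intro tendsto_intros)
  then have lim: "((\<lambda>u. ereal (K * norm (u - z))) \<longlongrightarrow> ereal 0) (at z within C)"
    by (simp add: tendsto_ereal)
  have "x \<bullet> (u - z) / norm (u - z) \<le> K * norm (u - z)" if "u \<in> C" "u \<noteq> z" for u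
    using prox[OF that(1)] that(2)
    by (simp add: divide_le_eq dot_square_norm power2_eq_square mult.assoc)
  then have ev: "eventually (\<lambda>u. ereal (x \<bullet> (u - z) / norm (u - z)) \<le> ereal (K * norm (u - z)))
      (at z within C)"
    by (auto simp: eventually_at_filter)
  have "Limsup (at z within C) (\<lambda>u. ereal (x \<bullet> (u - z) / norm (u - z))) \<le> 0"
  proof (cases "at z within C = bot")
    case True
    then show ?thesis by simp
  next
    case False
    have "Limsup (at z within C) (\<lambda>u. ereal (x \<bullet> (u - z) / norm (u - z)))
        \<le> Limsup (at z within C) (\<lambda>u. ereal (K * norm (u - z)))"
      by (rule Limsup_mono[OF ev])
    also have "\<dots> = 0"
      using lim_imp_Limsup[OF False lim] by (simp add: zero_ereal_def)
    finally show ?thesis .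
  qed
  then show ?thesis using \<open>z \<in> C\<close> by (simp add: regular_normal_cone_def)
qed

text \<open>Along a segment from \<open>z\<close> inside \<open>S\<close> the quotient of the limsup is constant, so its sign is
  already decided near \<open>z\<close>.\<close>

lemma regular_normal_cone_convex:
  fixes z :: "'a::euclidean_space"
  assumes x: "x \<in> regular_normal_cone C z"
    and S: "convex S" "S \<subseteq> C" "z \<in> S" "u \<in> S"
  shows "x \<bullet> (u - z) \<le> 0"
proof (rule ccontr)
  assume "\<not> x \<bullet> (u - z) \<le> 0"
  then have pos: "x \<bullet> (u - z) > 0" by simp
  then have uz: "norm (u - z) > 0" by auto
  define k where "k = x \<bullet> (u - z) / norm (u - z)"
  have "k > 0" using pos uz by (simp add: k_def)
  have "Limsup (at z within C) (\<lambda>v. ereal (x \<bullet> (v - z) / norm (v - z))) \<le> 0"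
    using x S by (auto simp: regular_normal_cone_def split: if_splits)
  then have "Limsup (at z within C) (\<lambda>v. ereal (x \<bullet> (v - z) / norm (v - z))) < ereal k"
    using \<open>k > 0\<close> by (metis ereal_less(2) order_le_less_trans)
  then have "eventually (\<lambda>v. ereal (x \<bullet> (v - z) / norm (v - z)) < ereal k) (at z within C)"
    by (rule Limsup_lessD)
  then obtain d where "d > 0"
    and d: "\<And>v. v \<in> C \<Longrightarrow> v \<noteq> z \<Longrightarrow> dist v z < d \<Longrightarrow> x \<bullet> (v - z) / norm (v - z) < k"
    by (auto simp: eventually_at)
  define t where "t = min 1 (d / (2 * norm (u - z)))"
  have t: "0 < t" "t \<le> 1" "t * norm (u - z) < d"
  proof -
    show "0 < t" "t \<le> 1" using \<open>d > 0\<close> uz by (auto simp: t_def)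
    have "t * norm (u - z) \<le> d / (2 * norm (u - z)) * norm (u - z)"
      unfolding t_def by (intro mult_right_mono) auto
    also have "\<dots> < d" using \<open>d > 0\<close> uz by simp
    finally show "t * norm (u - z) < d" .
  qed
  define v where "v = z + t *\<^sub>R (u - z)"
  have "v = (1 - t) *\<^sub>R z + t *\<^sub>R u" by (simp add: v_def algebra_simps)
  then have "v \<in> S" using S t convexD_alt[of S z u t] by simp
  moreover have "v \<noteq> z" using t uz by (auto simp: v_def)
  moreover have "dist v z < d" using t by (simp add: v_def dist_norm)
  ultimately have "x \<bullet> (v - z) / norm (v - z) < k" using d S by blast
  moreover have "x \<bullet> (v - z) / norm (v - z) = k"
    using t uz by (simp add: v_def k_def)
  ultimately show False by simp
qed

lemma proj_set_imp_regular_normal: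
  fixes s :: "'a::euclidean_space"
  assumes "y \<in> proj_set Z s"
  shows "s - y \<in> regular_normal_cone Z y"
proof (rule proximal_in_regular_normal_cone[where K = "1/2"])
  show "y \<in> Z" using assms by (simp add: proj_set_iff)
  show "(s - y) \<bullet> (u - y) \<le> 1/2 * ((u - y) \<bullet> (u - y))" if "u \<in> Z" for u
    using assms that by (auto simp: proj_set_iff_inner)
qed

section \<open>Finite unions of polyhedra\<close>

lemma polyhedron_linear_vimage:
  fixes f :: "'a::euclidean_space \<Rightarrow> 'b::euclidean_space"
  assumes "linear f" "polyhedron S"
  shows "polyhedron (f -` S)"
proof -
  obtain \<H> where \<H>: "finite \<H>" "S = \<Inter>\<H>"
      "\<And>h. h \<in> \<H> \<Longrightarrow> \<exists>a b. a \<noteq> 0 \<and> h = {x. a \<bullet> x \<le> b}"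
    using assms(2) unfolding polyhedron_def by metis
  have "polyhedron (f -` h)" if "h \<in> \<H>" for h
  proof -
    obtain a b where h: "h = {x. a \<bullet> x \<le> b}" using \<H>(3) \<open>h \<in> \<H>\<close> by blast
    have "f -` h = {x. adjoint f a \<bullet> x \<le> b}"
      by (simp add: h vimage_def adjoint_works[OF assms(1)] inner_commute[of a] inner_commute[of "adjoint f a"])
    then show ?thesis by (simp add: polyhedron_halfspace_le)
  qed
  moreover have "f -` S = \<Inter> ((\<lambda>h. f -` h) ` \<H>)" using \<H>(2) by auto
  ultimately show ?thesis using \<H>(1) by (auto intro!: polyhedron_Inter)
qed

lemma linear_block_part: "linear (block_part blk k)"
  by (rule linearI) (auto simp: block_part_def vec_eq_iff algebra_simps)

text \<open>Distributing the product over the unions gives one polyhedron for every choice of a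
  polyhedron in each block.\<close>

lemma product_of_unions_eq_Union_polyhedra:
  fixes Zc :: "nat \<Rightarrow> nat \<Rightarrow> (real^'n) set"
  assumes "\<And>k i. k \<in> {1..N} \<Longrightarrow> i \<in> {1..mk k} \<Longrightarrow> polyhedron (Zc k i)"
  obtains \<P> where "finite \<P>" "\<And>S. S \<in> \<P> \<Longrightarrow> polyhedron S"
    "product_of_unions blk N mk Zc = \<Union>\<P>"
proof
  define \<Sigma> where "\<Sigma> = (\<Pi>\<^sub>E k\<in>{1..N}. {1..mk k})"
  define piece where "piece \<sigma> = (\<Inter>k\<in>{1..N}. block_part blk k -` Zc k (\<sigma> k))" for \<sigma>
  show "finite (piece ` \<Sigma>)" by (simp add: \<Sigma>_def finite_PiE)
  show "polyhedron S" if "S \<in> piece ` \<Sigma>" for S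
  proof -
    obtain \<sigma> where "\<sigma> \<in> \<Sigma>" "S = piece \<sigma>" using \<open>S \<in> piece ` \<Sigma>\<close> by blast
    moreover have "polyhedron (block_part blk k -` Zc k (\<sigma> k))" if "k \<in> {1..N}" for k
    proof (rule polyhedron_linear_vimage[OF linear_block_part])
      show "polyhedron (Zc k (\<sigma> k))"
        using assms that \<open>\<sigma> \<in> \<Sigma>\<close> by (auto simp: \<Sigma>_def PiE_iff)
    qed
    ultimately show ?thesis unfolding piece_def by (auto intro!: polyhedron_Inter)
  qed
  show "product_of_unions blk N mk Zc = \<Union> (piece ` \<Sigma>)"
  proof (intro equalityI subsetI)
    fix z assume "z \<in> product_of_unions blk N mk Zc"
    then have "\<forall>k\<in>{1..N}. \<exists>i. i \<in> {1..mk k} \<and> block_part blk k z \<in> Zc k i"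
      unfolding product_of_unions_def by blast
    then obtain \<sigma> where \<sigma>: "\<forall>k\<in>{1..N}. \<sigma> k \<in> {1..mk k} \<and> block_part blk k z \<in> Zc k (\<sigma> k)"
      by metis
    then have "restrict \<sigma> {1..N} \<in> \<Sigma>" by (auto simp: \<Sigma>_def)
    moreover have "z \<in> piece (restrict \<sigma> {1..N})" using \<sigma> by (auto simp: piece_def)
    ultimately show "z \<in> \<Union> (piece ` \<Sigma>)" by blast
  next
    fix z assume "z \<in> \<Union> (piece ` \<Sigma>)"
    then obtain \<sigma> where \<sigma>: "\<sigma> \<in> \<Sigma>" "z \<in> piece \<sigma>" by blast
    have "block_part blk k z \<in> (\<Union>i\<in>{1..mk k}. Zc k i)" if "k \<in> {1..N}" for k
    proof (rule UN_I)
      show "\<sigma> k \<in> {1..mk k}" using \<sigma>(1) that unfolding \<Sigma>_def by (rule PiE_mem)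
      show "block_part blk k z \<in> Zc k (\<sigma> k)" using \<sigma>(2) that by (auto simp: piece_def)
    qed
    then show "z \<in> product_of_unions blk N mk Zc"
      by (simp add: product_of_unions_def)
  qed
qed

lemma only_active_pieces_nearby:
  fixes z :: "'a::metric_space"
  assumes "finite \<P>" "\<And>S. S \<in> \<P> \<Longrightarrow> closed S"
  obtains d where "d > 0" "\<And>S u. S \<in> \<P> \<Longrightarrow> u \<in> S \<Longrightarrow> dist u z < d \<Longrightarrow> z \<in> S"
proof -
  define C where "C = \<Union>{S \<in> \<P>. z \<notin> S}"
  have "open (- C)" unfolding C_def using assms by (intro open_Compl closed_Union) auto
  moreover have "z \<in> - C" by (auto simp: C_def)
  ultimately obtain d where "d > 0" and d: "\<And>u. dist u z < d \<Longrightarrow> u \<notin> C"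
    unfolding open_dist by (metis ComplD)
  have "z \<in> S" if "S \<in> \<P>" "u \<in> S" "dist u z < d" for S u
    using d[OF that(3)] that by (auto simp: C_def)
  with \<open>d > 0\<close> show ?thesis by (rule that)
qed

section \<open>The projection onto a finite union of polyhedra near a non-degenerate point\<close>

locale orthogonal_projection =
  fixes P :: "'a::euclidean_space \<Rightarrow> 'a" and L :: "'a set"
  assumes linear: "linear P"
    and range: "P x \<in> L"
    and orth: "l \<in> L \<Longrightarrow> (x - P x) \<bullet> l = 0"
    and id: "l \<in> L \<Longrightarrow> P l = l"
begin

lemma self_adjoint: "P x \<bullet> y = x \<bullet> P y"
  using orth[OF range, of x y] orth[OF range, of y x]
  by (simp add: inner_diff inner_commute)

lemma split_inner: "x \<bullet> y = P x \<bullet> P y + (x - P x) \<bullet> (y - P y)"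
  using orth[OF range, of x y] orth[OF range, of y x]
  by (simp add: inner_diff inner_commute algebra_simps)

lemma norm_bounds: "norm (P x) \<le> norm x" "norm (x - P x) \<le> norm x"
  unfolding norm_le using split_inner[of x x] by auto

end

lemma orthogonal_projection_exists:
  fixes L :: "'a::euclidean_space set"
  assumes "subspace L"
  obtains P where "orthogonal_projection P L"
proof -
  obtain B where B: "B \<subseteq> L" "pairwise orthogonal B" "\<And>x. x \<in> B \<Longrightarrow> norm x = 1"
      "independent B" "span B = L"
    using orthonormal_basis_subspace[OF assms] by metis
  have "finite B" using B(4) by (rule independent_imp_finite)
  define P where "P x = (\<Sum>b\<in>B. (x \<bullet> b) *\<^sub>R b)" for x
  have Pb: "P x \<bullet> b = x \<bullet> b" if "b \<in> B" for x b
  proof -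
    have "P x \<bullet> b = (\<Sum>b'\<in>B. if b' = b then x \<bullet> b else 0)"
      unfolding P_def inner_sum_left
    proof (intro sum.cong refl)
      fix b' assume "b' \<in> B"
      then show "(x \<bullet> b') *\<^sub>R b' \<bullet> b = (if b' = b then x \<bullet> b else 0)"
        using B(2) B(3)[OF that] that
        by (auto simp: pairwise_def orthogonal_def dot_square_norm)
    qed
    then show ?thesis using \<open>finite B\<close> that by simp
  qed
  have PL: "P x \<in> L" for x
    unfolding P_def B(5)[symmetric] by (intro span_sum span_scale span_base)
  have orth: "(x - P x) \<bullet> l = 0" if "l \<in> L" for x l
  proof -
    have "l \<in> span B" using that B(5) by simp
    then have "orthogonal (x - P x) l"
    proof (rule orthogonal_to_span)
      show "orthogonal (x - P x) b" if "b \<in> B" for b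
        using Pb[OF that] by (simp add: orthogonal_def inner_diff_left)
    qed
    then show ?thesis by (simp add: orthogonal_def)
  qed
  show ?thesis
  proof
    show "orthogonal_projection P L"
    proof (rule orthogonal_projection.intro)
      show "linear P"
        by (rule linearI)
           (simp_all add: P_def inner_add_left scaleR_add_left sum.distrib scaleR_sum_right)
      show "P l = l" if "l \<in> L" for l
      proof -
        have "l - P l \<in> L" using that PL assms subspace_diff by blast
        then have "(l - P l) \<bullet> (l - P l) = 0" by (rule orth)
        then show ?thesis by simp
      qed
    qed (use PL orth in auto)
  qed
qed

text \<open>On a polytope the decay of \<open>w \<bullet> (u - z)\<close> away from \<open>z + L\<close> is at least linear:
  both sides are controlled by their values at the finitely many vertices, and a vertex outside
  \<open>z + L\<close> has a strictly negative value.\<close>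

lemma polytope_linear_decay:
  fixes z w :: "'a::euclidean_space"
  assumes "orthogonal_projection P L" "polytope S"
    and nonpos: "\<And>u. u \<in> S \<Longrightarrow> w \<bullet> (u - z) \<le> 0"
    and face: "\<And>u. u \<in> S \<Longrightarrow> w \<bullet> (u - z) = 0 \<Longrightarrow> u - z \<in> L"
  obtains \<kappa> where "\<kappa> > 0"
    "\<And>u. u \<in> S \<Longrightarrow> \<kappa> * norm ((u - z) - P (u - z)) \<le> - (w \<bullet> (u - z))"
proof -
  interpret orthogonal_projection P L by fact
  interpret P: linear P by (rule linear)
  obtain T where T: "finite T" "S = convex hull T"
    using assms(2) unfolding polytope_def by blast
  have TS: "T \<subseteq> S" by (simp add: T(2) hull_subset)
  define k where "k v = (if w \<bullet> (v - z) = 0 then 1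
      else - (w \<bullet> (v - z)) / (norm ((v - z) - P (v - z)) + 1))" for v
  define \<kappa> where "\<kappa> = Min (insert 1 (k ` T))"
  have kpos: "k v > 0" if "v \<in> T" for v
  proof -
    have "0 < norm ((v - z) - P (v - z)) + 1" by (smt (verit) norm_ge_zero)
    moreover have "w \<bullet> (v - z) \<le> 0" using nonpos TS that by blast
    ultimately show ?thesis by (simp add: k_def divide_neg_pos)
  qed
  have \<kappa>: "\<kappa> > 0" "\<And>v. v \<in> T \<Longrightarrow> \<kappa> \<le> k v"
    using T(1) kpos by (auto simp: \<kappa>_def)
  have vertex: "\<kappa> * norm ((v - z) - P (v - z)) \<le> - (w \<bullet> (v - z))" if "v \<in> T" for v
  proof (cases "w \<bullet> (v - z) = 0")
    case True
    then have "P (v - z) = v - z" using face TS that id by blast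
    then show ?thesis using True by simp
  next
    case False
    let ?n = "norm ((v - z) - P (v - z))"
    have n1: "0 < ?n + 1" by (smt (verit) norm_ge_zero)
    have "\<kappa> * ?n \<le> k v * (?n + 1)"
      using \<kappa>(2)[OF that] \<kappa>(1) by (intro mult_mono) (auto intro: add_nonneg_nonneg)
    also have "\<dots> = - (w \<bullet> (v - z))" using False n1 by (simp add: k_def)
    finally show ?thesis .
  qed
  have "\<kappa> * norm ((u - z) - P (u - z)) \<le> - (w \<bullet> (u - z))" if "u \<in> S" for u
  proof -
    have "u \<in> convex hull T" using that T(2) by simp
    then obtain \<theta> where \<theta>: "\<forall>v\<in>T. 0 \<le> \<theta> v" "sum \<theta> T = 1" "(\<Sum>v\<in>T. \<theta> v *\<^sub>R v) = u"
      unfolding convex_hull_finite[OF T(1)] by (elim CollectE exE conjE)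
    have uz: "u - z = (\<Sum>v\<in>T. \<theta> v *\<^sub>R (v - z))"
    proof -
      have "(\<Sum>v\<in>T. \<theta> v *\<^sub>R (v - z)) = (\<Sum>v\<in>T. \<theta> v *\<^sub>R v) - sum \<theta> T *\<^sub>R z"
        unfolding scaleR_sum_left scaleR_diff_right sum_subtractf ..
      then show ?thesis using \<theta>(2,3) by simp
    qed
    have "(\<Sum>v\<in>T. \<theta> v *\<^sub>R ((v - z) - P (v - z)))
        = (\<Sum>v\<in>T. \<theta> v *\<^sub>R (v - z)) - P (\<Sum>v\<in>T. \<theta> v *\<^sub>R (v - z))"
      unfolding P.sum P.scale scaleR_diff_right[of _ "_ - _" "P _"] sum_subtractf ..
    then have "(u - z) - P (u - z) = (\<Sum>v\<in>T. \<theta> v *\<^sub>R ((v - z) - P (v - z)))"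
      by (simp only: uz)
    then have "norm ((u - z) - P (u - z))
        \<le> (\<Sum>v\<in>T. norm (\<theta> v *\<^sub>R ((v - z) - P (v - z))))"
      by (simp only: norm_sum)
    also have "\<dots> = (\<Sum>v\<in>T. \<theta> v * norm ((v - z) - P (v - z)))"
      using \<theta>(1) by (intro sum.cong) auto
    finally have "norm ((u - z) - P (u - z)) \<le> (\<Sum>v\<in>T. \<theta> v * norm ((v - z) - P (v - z)))" .
    then have "\<kappa> * norm ((u - z) - P (u - z))
        \<le> \<kappa> * (\<Sum>v\<in>T. \<theta> v * norm ((v - z) - P (v - z)))"
      using \<kappa>(1) by simp
    also have "\<dots> = (\<Sum>v\<in>T. \<theta> v * (\<kappa> * norm ((v - z) - P (v - z))))"
      by (simp add: sum_distrib_left algebra_simps)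
    also have "\<dots> \<le> (\<Sum>v\<in>T. \<theta> v * (- (w \<bullet> (v - z))))"
      using \<theta>(1) vertex by (intro sum_mono mult_left_mono) auto
    also have "\<dots> = - (w \<bullet> (u - z))"
      by (simp add: uz inner_sum_right sum_negf)
    finally show ?thesis .
  qed
  then show ?thesis using that \<kappa>(1) by blast
qed

text \<open>Since \<open>z\<close> is the only nearest point of \<open>Z\<close> to \<open>z + w\<close>, points close to \<open>z + w\<close> have
  their nearest points close to \<open>z\<close>.  There the linear decay beats the first-order gain that
  leaving \<open>z + L\<close> could bring, so the nearest point lies in \<open>z + L\<close>, which is locally part of
  \<open>Z\<close>.\<close>

lemma proj_set_locally_affine:
  fixes z w :: "'a::euclidean_space"
  assumes P: "orthogonal_projection P L"
    and \<P>: "finite \<P>" "\<And>S. S \<in> \<P> \<Longrightarrow> polyhedron S"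
    and Z: "Z = \<Union>\<P>" and z: "z \<in> Z"
    and strict: "\<And>u. u \<in> Z \<Longrightarrow> u \<noteq> z \<Longrightarrow> 2 * (w \<bullet> (u - z)) < (u - z) \<bullet> (u - z)"
    and nonpos: "\<And>S u. S \<in> \<P> \<Longrightarrow> z \<in> S \<Longrightarrow> u \<in> S \<Longrightarrow> w \<bullet> (u - z) \<le> 0"
    and face: "\<And>S u. S \<in> \<P> \<Longrightarrow> z \<in> S \<Longrightarrow> u \<in> S \<Longrightarrow> w \<bullet> (u - z) = 0 \<Longrightarrow> u - z \<in> L"
    and w: "\<And>l. l \<in> L \<Longrightarrow> w \<bullet> l = 0"
    and \<epsilon>: "\<epsilon> > 0" "\<And>l. l \<in> L \<Longrightarrow> norm l \<le> \<epsilon> \<Longrightarrow> z + l \<in> Z"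
  obtains r where "r > 0"
    "\<And>s y. norm (s - (z + w)) < r \<Longrightarrow> y \<in> proj_set Z s \<Longrightarrow> y = z + P (s - (z + w))"
proof -
  interpret orthogonal_projection P L by fact
  have closedS: "closed S" if "S \<in> \<P>" for S
    using \<P>(2)[OF that] by (rule polyhedron_imp_closed)
  then have closed: "closed Z" unfolding Z using \<P>(1) by (intro closed_Union) auto
  obtain d where "d > 0" and d: "\<And>S u. S \<in> \<P> \<Longrightarrow> u \<in> S \<Longrightarrow> dist u z < d \<Longrightarrow> z \<in> S"
    using only_active_pieces_nearby[OF \<P>(1) closedS] by blast
  define Box where "Box = cbox (z - One) (z + One)"
  have "z \<in> box (z - One) (z + One)" by (simp add: mem_box algebra_simps)
  then obtain d' where "d' > 0" and d'': "ball z d' \<subseteq> box (z - One) (z + One)"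
    using open_box[unfolded open_contains_ball] by metis
  have d': "ball z d' \<subseteq> Box"
    unfolding Box_def using d'' box_subset_cbox by (rule subset_trans)
  define \<eta> where "\<eta> = min d d'"
  have "\<eta> > 0" using \<open>d > 0\<close> \<open>d' > 0\<close> by (simp add: \<eta>_def)
  have "\<exists>\<kappa>>0. \<forall>u\<in>S \<inter> Box. \<kappa> * norm ((u - z) - P (u - z)) \<le> - (w \<bullet> (u - z))"
    if S: "S \<in> {S \<in> \<P>. z \<in> S}" for S
  proof -
    have "polytope (S \<inter> Box)"
      unfolding polytope_eq_bounded_polyhedron Box_def using \<P>(2) S
      by (auto simp: polytope_interval polytope_imp_polyhedron bounded_Int)
    then obtain \<kappa> where "\<kappa> > 0"
      "\<And>u. u \<in> S \<inter> Box \<Longrightarrow> \<kappa> * norm ((u - z) - P (u - z)) \<le> - (w \<bullet> (u - z))"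
      by (rule polytope_linear_decay[OF P, of _ w z]) (use nonpos face S in auto)
    then show ?thesis by (intro exI[of _ \<kappa>]) simp
  qed
  then have "\<forall>S\<in>{S \<in> \<P>. z \<in> S}. \<exists>\<kappa>>0. \<forall>u\<in>S \<inter> Box.
      \<kappa> * norm ((u - z) - P (u - z)) \<le> - (w \<bullet> (u - z))" ..
  from bchoice[OF this] obtain k where
    k: "\<And>S. S \<in> \<P> \<Longrightarrow> z \<in> S \<Longrightarrow> k S > 0"
    "\<And>S u. S \<in> \<P> \<Longrightarrow> z \<in> S \<Longrightarrow> u \<in> S \<Longrightarrow> u \<in> Box \<Longrightarrow>
        k S * norm ((u - z) - P (u - z)) \<le> - (w \<bullet> (u - z))"
    by auto
  define \<kappa> where "\<kappa> = Min (insert 1 (k ` {S \<in> \<P>. z \<in> S}))"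
  have "\<kappa> > 0" using \<P>(1) k(1) by (auto simp: \<kappa>_def)
  have \<kappa>: "\<kappa> * norm ((u - z) - P (u - z)) \<le> - (w \<bullet> (u - z))"
    if "S \<in> \<P>" "z \<in> S" "u \<in> S" "u \<in> Box" for S u
  proof -
    have "\<kappa> \<le> k S" using \<P>(1) that by (auto simp: \<kappa>_def)
    then have "\<kappa> * norm ((u - z) - P (u - z)) \<le> k S * norm ((u - z) - P (u - z))"
      by (intro mult_right_mono) auto
    then show ?thesis using k(2)[OF that] by linarith
  qed
  \<comment> \<open>Points of the union away from \<open>z\<close> are farther from \<open>z + w\<close> than \<open>z\<close>, by a margin.\<close>
  define K where "K = Z \<inter> {u. norm (u - z) \<ge> \<eta>}"
  have "\<exists>g>0. \<forall>u\<in>K. norm w + g \<le> norm (z + w - u)"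
  proof (cases "K = {}")
    case True
    then show ?thesis by (intro exI[of _ 1]) auto
  next
    case False
    have "closed {u. norm (u - z) \<ge> \<eta>}"
      by (intro closed_Collect_le continuous_intros)
    then have "closed K" unfolding K_def using closed by (rule closed_Int[rotated])
    from distance_attains_inf[OF this False, of "z + w"] obtain x
      where x: "x \<in> K" and min: "\<And>u. u \<in> K \<Longrightarrow> dist (z + w) x \<le> dist (z + w) u"
      by metis
    have "x \<in> Z" "x \<noteq> z" using x \<open>\<eta> > 0\<close> by (auto simp: K_def)
    then have "2 * (w \<bullet> (x - z)) < (x - z) \<bullet> (x - z)" by (rule strict)
    then have "norm w < norm (z + w - x)"
      unfolding norm_lt by (simp add: inner_diff inner_add inner_commute algebra_simps)
    moreover have "norm (z + w - x) \<le> norm (z + w - u)" if "u \<in> K" for u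
      using min[OF that] by (simp add: dist_norm)
    ultimately show ?thesis
      by (intro exI[of _ "norm (z + w - x) - norm w"]) auto
  qed
  then obtain g where "g > 0"
    and g: "\<And>u. u \<in> K \<Longrightarrow> norm w + g \<le> norm (z + w - u)"
    by metis
  define r where "r = min (g / 2) (min \<kappa> \<epsilon>)"
  have "r > 0" using \<open>g > 0\<close> \<open>\<kappa> > 0\<close> \<open>\<epsilon> > 0\<close> by (simp add: r_def)
  moreover have "y = z + P (s - (z + w))"
    if s: "norm (s - (z + w)) < r" and y: "y \<in> proj_set Z s" for s y
  proof -
    define \<delta> where "\<delta> = s - (z + w)"
    define u where "u = y - z"
    have \<delta>: "norm \<delta> < g / 2" "norm \<delta> < \<kappa>" "norm \<delta> < \<epsilon>" using s by (auto simp: \<delta>_def r_def)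
    have yZ: "y \<in> Z" and ymin: "\<And>v. v \<in> Z \<Longrightarrow> norm (s - y) \<le> norm (s - v)"
      using y by (auto simp: proj_set_iff)
    have "z + w - y = (s - y) - \<delta>" by (simp add: \<delta>_def)
    then have "norm (z + w - y) \<le> norm (s - y) + norm \<delta>"
      by (simp only: norm_triangle_ineq4)
    also have "norm (s - y) \<le> norm (s - z)" by (rule ymin[OF z])
    also have "norm (s - z) \<le> norm w + norm \<delta>"
      using norm_triangle_ineq[of w \<delta>] by (simp add: \<delta>_def)
    finally have "norm (z + w - y) < norm w + g" using \<delta>(1) by simp
    then have "y \<notin> K" using g[of y] by linarith
    then have "norm (y - z) < \<eta>" using yZ by (simp add: K_def)
    then have near: "dist y z < d" "y \<in> Box"
      using subsetD[OF d', of y] by (simp_all add: \<eta>_def dist_norm norm_minus_commute)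
    obtain S where S: "S \<in> \<P>" "y \<in> S" using yZ unfolding Z by (rule UnionE)
    then have "z \<in> S" using d near(1) by metis
    then have dec: "\<kappa> * norm (u - P u) \<le> - (w \<bullet> u)"
      using \<kappa>[OF S(1) _ S(2) near(2)] by (simp add: u_def)
    have "z + P \<delta> \<in> Z"
      using norm_bounds(1)[of \<delta>] \<delta>(3) by (intro \<epsilon>(2) range) simp
    from ymin[OF this] have "norm (w + \<delta> - u) \<le> norm (w + \<delta> - P \<delta>)"
      by (simp add: \<delta>_def u_def algebra_simps)
    then have le: "- 2 * (w \<bullet> u) + (\<delta> - u) \<bullet> (\<delta> - u) \<le> (\<delta> - P \<delta>) \<bullet> (\<delta> - P \<delta>)"
      unfolding norm_le using w[OF range[of \<delta>]]
      by (simp add: inner_diff inner_add inner_commute algebra_simps)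
    define a where "a = \<delta> - P \<delta>"
    define u' where "u' = u - P u"
    have Pd: "P (\<delta> - u) = P \<delta> - P u" by (rule linear_diff[OF linear])
    have "(\<delta> - u) \<bullet> (\<delta> - u) = (P \<delta> - P u) \<bullet> (P \<delta> - P u) + (a - u') \<bullet> (a - u')"
      using split_inner[of "\<delta> - u" "\<delta> - u"] by (simp add: Pd a_def u'_def algebra_simps)
    also have "(a - u') \<bullet> (a - u') = a \<bullet> a - 2 * (a \<bullet> u') + u' \<bullet> u'"
      by (simp add: inner_diff inner_commute)
    finally have "2 * \<kappa> * norm u' + (P \<delta> - P u) \<bullet> (P \<delta> - P u) + u' \<bullet> u' \<le> 2 * (a \<bullet> u')"
      using le dec by (simp add: a_def u'_def)
    also have "a \<bullet> u' \<le> \<kappa> * norm u'"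
    proof -
      have "a \<bullet> u' \<le> norm a * norm u'" by (rule norm_cauchy_schwarz)
      also have "\<dots> \<le> \<kappa> * norm u'"
        using norm_bounds(2)[of \<delta>] \<delta>(2) by (intro mult_right_mono) (auto simp: a_def)
      finally show ?thesis .
    qed
    finally have "(P \<delta> - P u) \<bullet> (P \<delta> - P u) + u' \<bullet> u' \<le> 0" by simp
    then have "P \<delta> - P u = 0" "u' = 0"
      by (smt (verit) inner_ge_zero inner_eq_zero_iff)+
    then show ?thesis by (simp add: u_def u'_def \<delta>_def algebra_simps)
  qed
  ultimately show ?thesis using that by blast
qed

section \<open>Convergence of the linearised iteration\<close>

lemma power2_norm_tendsto_zeroD:
  fixes x :: "nat \<Rightarrow> 'a::real_normed_vector"
  assumes "(\<lambda>j. (norm (x j))\<^sup>2) \<longlonglongrightarrow> 0"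
  shows "x \<longlonglongrightarrow> 0"
proof -
  have "(\<lambda>j. sqrt ((norm (x j))\<^sup>2)) \<longlonglongrightarrow> sqrt 0"
    by (intro tendsto_real_sqrt assms)
  then show ?thesis by (simp add: tendsto_norm_zero_iff)
qed

text \<open>The decrease of \<open>q\<close> forces \<open>B (e j) \<longlonglongrightarrow> 0\<close>, so every cluster point \<open>l\<close> of the bounded sequence
  \<open>e\<close> is a zero of \<open>B\<close>.  Then \<open>e j - l\<close> obeys the same recursion, and \<open>q (e j - l)\<close> is monotone
  with a subsequence tending to \<open>0\<close>.\<close>

lemma linear_Krasnoselskii_Mann:
  fixes B :: "'a::euclidean_space \<Rightarrow> 'a" and q :: "'a \<Rightarrow> real"
  assumes B: "linear B" and c: "c > 0" "\<And>x. c * (norm x)\<^sup>2 \<le> q x"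
    and q: "isCont q 0" "q 0 = 0"
    and k: "k > 0" "\<And>x. q (x - \<gamma> *\<^sub>R B x) \<le> q x - k * (norm (B x))\<^sup>2"
    and e: "\<And>j. e (Suc j) = e j - \<gamma> *\<^sub>R B (e j)"
  shows "convergent e"
proof -
  have nonneg: "0 \<le> q x" for x
    using c(1) c(2)[of x] by (smt (verit) mult_nonneg_nonneg zero_le_power2)
  have decr: "decseq (\<lambda>j. q (a j))" if "\<And>j. a (Suc j) = a j - \<gamma> *\<^sub>R B (a j)" for a
  proof (rule decseq_SucI)
    fix j
    have "q (a (Suc j)) \<le> q (a j) - k * (norm (B (a j)))\<^sup>2" by (simp add: that k(2))
    also have "\<dots> \<le> q (a j)" using k(1) by simp
    finally show "q (a (Suc j)) \<le> q (a j)" .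
  qed
  obtain Q where Q: "(\<lambda>j. q (e j)) \<longlonglongrightarrow> Q"
    by (rule decseq_convergent[OF decr[of e, OF e], of 0]) (simp_all add: nonneg)
  have "(\<lambda>j. (q (e j) - q (e (Suc j))) / k) \<longlonglongrightarrow> (Q - Q) / k"
    by (intro tendsto_intros Q LIMSEQ_Suc) (use k(1) in simp)
  then have "(\<lambda>j. (q (e j) - q (e (Suc j))) / k) \<longlonglongrightarrow> 0" by simp
  then have "(\<lambda>j. (norm (B (e j)))\<^sup>2) \<longlonglongrightarrow> 0"
  proof (rule tendsto_sandwich[OF _ _ tendsto_const, rotated 2])
    have "(norm (B (e j)))\<^sup>2 \<le> (q (e j) - q (e (Suc j))) / k" for j
      using k(2)[of "e j"] k(1) by (simp add: e field_simps)
    then show "\<forall>\<^sub>F j in sequentially. (norm (B (e j)))\<^sup>2 \<le> (q (e j) - q (e (Suc j))) / k" by simp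
  qed auto
  then have Be: "(\<lambda>j. B (e j)) \<longlonglongrightarrow> 0"
    by (rule power2_norm_tendsto_zeroD)
  have "bounded (range e)"
  proof (rule boundedI)
    fix x assume "x \<in> range e"
    then obtain j where j: "x = e j" by blast
    have "c * (norm x)\<^sup>2 \<le> q (e 0)"
      using c(2)[of x] decseqD[OF decr[of e, OF e], of 0 j] by (simp add: j)
    then have "(norm x)\<^sup>2 \<le> q (e 0) / c" using c(1) by (simp add: field_simps)
    then show "norm x \<le> sqrt (q (e 0) / c)" by (rule real_le_rsqrt)
  qed
  then obtain l \<rho> where \<rho>: "strict_mono \<rho>" "(e \<circ> \<rho>) \<longlonglongrightarrow> l"
    using bounded_imp_convergent_subsequence by blast
  have "(\<lambda>j. B ((e \<circ> \<rho>) j)) \<longlonglongrightarrow> B l"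
    by (rule isCont_tendsto_compose[OF linear_continuous_at \<rho>(2)])
      (use B in \<open>simp add: linear_conv_bounded_linear\<close>)
  moreover have "(\<lambda>j. B ((e \<circ> \<rho>) j)) \<longlonglongrightarrow> 0"
    using LIMSEQ_subseq_LIMSEQ[OF Be \<rho>(1)] by (simp add: o_def)
  ultimately have "B l = 0" by (rule LIMSEQ_unique)
  define a where "a j = e j - l" for j
  have a: "a (Suc j) = a j - \<gamma> *\<^sub>R B (a j)" for j
    by (simp add: a_def e linear_diff[OF B] \<open>B l = 0\<close>)
  have "(\<lambda>j. (a \<circ> \<rho>) j) \<longlonglongrightarrow> 0"
    using LIM_zero[OF \<rho>(2)] unfolding a_def o_def .
  then have "(\<lambda>j. q ((a \<circ> \<rho>) j)) \<longlonglongrightarrow> q 0"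
    by (rule isCont_tendsto_compose[OF q(1)])
  then have sub: "((\<lambda>j. q (a j)) \<circ> \<rho>) \<longlonglongrightarrow> 0" by (simp add: q(2) o_def)
  obtain Q' where Q': "(\<lambda>j. q (a j)) \<longlonglongrightarrow> Q'"
    by (rule decseq_convergent[OF decr[of a, OF a], of 0]) (simp_all add: nonneg)
  have "Q' = 0" using LIMSEQ_unique[OF LIMSEQ_subseq_LIMSEQ[OF Q' \<rho>(1)] sub] .
  then have "(\<lambda>j. q (a j) / c) \<longlonglongrightarrow> 0" using tendsto_divide[OF Q' tendsto_const[of c]] c(1) by simp
  then have "(\<lambda>j. (norm (a j))\<^sup>2) \<longlonglongrightarrow> 0"
  proof (rule tendsto_sandwich[OF _ _ tendsto_const, rotated 2])
    have "(norm (a j))\<^sup>2 \<le> q (a j) / c" for j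
      using c(2)[of "a j"] c(1) by (simp add: field_simps)
    then show "\<forall>\<^sub>F j in sequentially. (norm (a j))\<^sup>2 \<le> q (a j) / c" by simp
  qed auto
  then have "a \<longlonglongrightarrow> 0"
    by (rule power2_norm_tendsto_zeroD)
  then have "e \<longlonglongrightarrow> l" unfolding a_def by (rule LIM_zero_cancel)
  then show ?thesis by (rule convergentI)
qed

text \<open>With \<open>r = x - P x\<close>, the expression equals
  \<open>3/2 * (norm r)\<^sup>2 + 3/2 * (norm (P y))\<^sup>2 - 1/2 * (norm v)\<^sup>2\<close>, where \<open>v\<close> is the part of
  \<open>P y - r\<close> orthogonal to \<open>U\<close>; and \<open>P y\<close> and \<open>r\<close> are orthogonal.\<close>

lemma two_projections_inequality:
  fixes e :: "'a::euclidean_space"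
  assumes P: "orthogonal_projection P L" and P': "orthogonal_projection P' U"
  defines "x \<equiv> P' e" and "y \<equiv> e - P' e" and "p \<equiv> P e"
  shows "0 \<le> 3/2 * (x \<bullet> x) - x \<bullet> p - 1/2 * (P' p \<bullet> P' p) + 2 * (y \<bullet> p)
    - (p - P' p) \<bullet> (p - P' p)"
proof -
  interpret P: orthogonal_projection P L by fact
  interpret P': orthogonal_projection P' U by fact
  define p1 p2 r where "p1 = P x" and "p2 = P y" and "r = x - p1"
  have "e = x + y" by (simp add: x_def y_def)
  then have p: "p = p1 + p2" by (simp add: p_def p1_def p2_def linear_add[OF P.linear])
  have "P (P v) = P v" for v by (simp add: P.id P.range)
  then have inner: "x \<bullet> p1 = p1 \<bullet> p1" "x \<bullet> p2 = p1 \<bullet> p2" "y \<bullet> p1 = p1 \<bullet> p2" "y \<bullet> p2 = p2 \<bullet> p2"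
    unfolding p1_def p2_def using P.self_adjoint by (metis inner_commute)+
  have rr: "r \<bullet> r = x \<bullet> x - p1 \<bullet> p1" and rp: "r \<bullet> p2 = 0"
    using inner by (simp_all add: r_def inner_diff inner_commute)
  have "p = x + (p2 - r)" by (simp add: p r_def)
  moreover have "P' x = x" by (simp add: x_def P'.id P'.range)
  ultimately have "p - P' p = (p2 - r) - P' (p2 - r)"
    by (simp add: linear_add[OF P'.linear])
  then have "(p - P' p) \<bullet> (p - P' p) \<le> (p2 - r) \<bullet> (p2 - r)"
    using P'.norm_bounds(2)[of "p2 - r"] by (simp add: norm_le)
  also have "\<dots> = p2 \<bullet> p2 + r \<bullet> r" using rp by (simp add: inner_diff inner_commute)
  finally have v: "(p - P' p) \<bullet> (p - P' p) \<le> p2 \<bullet> p2 + r \<bullet> r" .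
  have pp: "p \<bullet> p = P' p \<bullet> P' p + (p - P' p) \<bullet> (p - P' p)" by (rule P'.split_inner)
  have "p \<bullet> p = p1 \<bullet> p1 + 2 * (p1 \<bullet> p2) + p2 \<bullet> p2"
    by (simp add: p inner_add inner_commute)
  moreover have "x \<bullet> p = p1 \<bullet> p1 + p1 \<bullet> p2" "y \<bullet> p = p1 \<bullet> p2 + p2 \<bullet> p2"
    using inner by (simp_all add: p inner_add_right)
  moreover have "0 \<le> r \<bullet> r" "0 \<le> p2 \<bullet> p2" by simp_all
  ultimately show ?thesis using v pp rr by linarith
qed

abbreviation (input) M_diag :: "real^'d \<Rightarrow> 'd + 'm \<Rightarrow> real" where
  "M_diag \<Lambda> \<equiv> case_sum (\<lambda>i. \<Lambda> $ i) (\<lambda>_. 0)"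

abbreviation (input) W_diag :: "real^'d \<Rightarrow> 'd + 'm \<Rightarrow> real" where
  "W_diag \<Lambda> \<equiv> case_sum (\<lambda>i. 1/2 * inverse (\<Lambda> $ i)) (\<lambda>_. - 1)"

text \<open>The map \<open>W * (M - P)\<close> in the coordinates in which \<open>M\<close> and \<open>W\<close> are diagonal.\<close>

definition linear_step ::
    "real^'d \<Rightarrow> (real^('d::finite + 'm::finite) \<Rightarrow> real^('d + 'm)) \<Rightarrow> real^('d + 'm) \<Rightarrow> real^('d + 'm)"
  where "linear_step \<Lambda> P e = (\<chi> k. W_diag \<Lambda> k * (M_diag \<Lambda> k * e $ k - P e $ k))"

text \<open>The weights are the inverse absolute values of the diagonal of \<open>W\<close>, so that passing to the
  energy inner product reduces \<open>W\<close> to the signs \<open>1\<close> and \<open>-1\<close> on its two blocks.\<close>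

definition energy :: "real^'d \<Rightarrow> real^('d::finite + 'm::finite) \<Rightarrow> real" where
  "energy \<Lambda> e = (\<Sum>k\<in>UNIV. case_sum (\<lambda>i. 2 * \<Lambda> $ i) (\<lambda>_. 1) k * (e $ k)\<^sup>2)"

lemma energy_ge_norm:
  assumes "\<And>i. 1 \<le> \<Lambda> $ i"
  shows "(norm e)\<^sup>2 \<le> energy \<Lambda> (e :: real^('d::finite + 'm::finite))"
proof -
  have "(norm e)\<^sup>2 = (\<Sum>k\<in>UNIV. (e $ k)\<^sup>2)"
    unfolding power2_norm_eq_inner inner_vec_def by (simp add: power2_eq_square)
  also have "\<dots> \<le> energy \<Lambda> e"
    unfolding energy_def
  proof (rule sum_mono)
    fix k :: "'d + 'm"
    have "1 \<le> case_sum (\<lambda>i. 2 * \<Lambda> $ i) (\<lambda>_. 1) k"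
    proof (cases k)
      case (Inl i)
      then show ?thesis using assms[of i] by simp
    qed simp
    then show "(e $ k)\<^sup>2 \<le> case_sum (\<lambda>i. 2 * \<Lambda> $ i) (\<lambda>_. 1) k * (e $ k)\<^sup>2"
      by (simp add: mult_le_cancel_right1)
  qed
  finally show ?thesis .
qed

lemma isCont_energy: "isCont (energy \<Lambda>) e"
  unfolding energy_def by (intro continuous_intros)

lemma energy_zero [simp]: "energy \<Lambda> 0 = 0"
  by (simp add: energy_def)

lemma linear_linear_step:
  assumes "linear P"
  shows "linear (linear_step \<Lambda> P)"
  by (rule linearI)
     (simp_all add: linear_step_def vec_eq_iff linear_add[OF assms] linear_scale[OF assms]
       algebra_simps)

lemma orthogonal_projection_Inl:
  "orthogonal_projection
    (\<lambda>e :: real^('d::finite + 'm::finite). \<chi> k. case k of Inl i \<Rightarrow> e $ k | Inr _ \<Rightarrow> 0)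
    {e. \<forall>i. e $ Inr i = 0}"
  by (rule orthogonal_projection.intro)
     (auto simp: vec_eq_iff inner_vec_def linear_iff split: sum.split intro!: sum.neutral)

text \<open>In the energy inner product the full step (\<open>\<gamma> = 1\<close>) is nonexpansive, hence the damped
  steps are averaged; after expanding the squares this is \<open>two_projections_inequality\<close> for
  the projections onto \<open>L\<close> and onto the first block of coordinates.\<close>

lemma linear_step_averaged:
  fixes P :: "real^('d::finite + 'm::finite) \<Rightarrow> real^('d + 'm)"
  assumes P: "orthogonal_projection P L" and \<Lambda>: "\<And>i. 1 \<le> \<Lambda> $ i" and "0 \<le> \<gamma>"
  shows "energy \<Lambda> (e - \<gamma> *\<^sub>R linear_step \<Lambda> P e)
    \<le> energy \<Lambda> e - \<gamma> * (1 - \<gamma>) * energy \<Lambda> (linear_step \<Lambda> P e)"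
proof -
  define P' :: "real^('d + 'm) \<Rightarrow> real^('d + 'm)"
    where "P' e = (\<chi> k. case k of Inl i \<Rightarrow> e $ k | Inr _ \<Rightarrow> 0)" for e
  define p where "p = P e"
  define f where "f = linear_step \<Lambda> P e"
  define d :: "'d + 'm \<Rightarrow> real" where "d = case_sum (\<lambda>i. 2 * \<Lambda> $ i) (\<lambda>_. 1)"
  have scalar: "3/2 * t\<^sup>2 - t * s - 1/2 * s\<^sup>2
      \<le> 2 * (2 * l) * (t * (1/2 * inverse l * (l * t - s)))
        - 2 * l * (1/2 * inverse l * (l * t - s))\<^sup>2"
    if "1 \<le> l" for l t s :: real
  proof -
    have "2 * (2 * l) * (t * (1/2 * inverse l * (l * t - s)))
        - 2 * l * (1/2 * inverse l * (l * t - s))\<^sup>2 = 3/2 * (l * t\<^sup>2) - t * s - 1/2 * (s\<^sup>2 / l)"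
      using that by (simp add: field_simps power2_eq_square)
    moreover have "1 * t\<^sup>2 \<le> l * t\<^sup>2" using that by (intro mult_right_mono) auto
    moreover have "s\<^sup>2 / l \<le> s\<^sup>2" using that by (simp add: divide_le_eq mult_le_cancel_left1)
    ultimately show ?thesis by linarith
  qed
  have "0 \<le> 3/2 * (P' e \<bullet> P' e) - P' e \<bullet> p - 1/2 * (P' p \<bullet> P' p) + 2 * ((e - P' e) \<bullet> p)
      - (p - P' p) \<bullet> (p - P' p)"
    using two_projections_inequality[OF P orthogonal_projection_Inl, of e]
    by (simp add: P'_def p_def)
  also have "\<dots> = (\<Sum>k\<in>UNIV. 3/2 * (P' e $ k)\<^sup>2 - P' e $ k * p $ k - 1/2 * (P' p $ k)\<^sup>2
      + 2 * ((e $ k - P' e $ k) * p $ k) - (p $ k - P' p $ k)\<^sup>2)"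
    by (simp add: inner_vec_def sum.distrib sum_subtractf sum_distrib_left power2_eq_square)
  also have "\<dots> \<le> (\<Sum>k\<in>UNIV. 2 * d k * (e $ k * f $ k) - d k * (f $ k)\<^sup>2)"
  proof (rule sum_mono)
    fix k
    show "3/2 * (P' e $ k)\<^sup>2 - P' e $ k * p $ k - 1/2 * (P' p $ k)\<^sup>2
        + 2 * ((e $ k - P' e $ k) * p $ k) - (p $ k - P' p $ k)\<^sup>2
        \<le> 2 * d k * (e $ k * f $ k) - d k * (f $ k)\<^sup>2"
    proof (cases k)
      case (Inl i)
      then show ?thesis using scalar[OF \<Lambda>[of i], of "e $ k" "p $ k"]
        by (simp add: P'_def d_def f_def linear_step_def p_def)
    next
      case (Inr i)
      then show ?thesis
        by (simp add: P'_def d_def f_def linear_step_def p_def)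
    qed
  qed
  finally have coco: "0 \<le> (\<Sum>k\<in>UNIV. 2 * d k * (e $ k * f $ k) - d k * (f $ k)\<^sup>2)" .
  have "energy \<Lambda> e - \<gamma> * (1 - \<gamma>) * energy \<Lambda> f - energy \<Lambda> (e - \<gamma> *\<^sub>R f)
      = (\<Sum>k\<in>UNIV. d k * (e $ k)\<^sup>2 - \<gamma> * (1 - \<gamma>) * (d k * (f $ k)\<^sup>2)
          - d k * (e $ k - \<gamma> * f $ k)\<^sup>2)"
    unfolding energy_def d_def[symmetric] by (simp add: sum_subtractf sum_distrib_left)
  also have "\<dots> = (\<Sum>k\<in>UNIV. \<gamma> * (2 * d k * (e $ k * f $ k) - d k * (f $ k)\<^sup>2))"
    by (intro sum.cong refl) (simp add: power2_eq_square algebra_simps)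
  also have "\<dots> = \<gamma> * (\<Sum>k\<in>UNIV. 2 * d k * (e $ k * f $ k) - d k * (f $ k)\<^sup>2)"
    by (simp add: sum_distrib_left)
  also have "\<dots> \<ge> 0" using coco \<open>0 \<le> \<gamma>\<close> by simp
  finally show ?thesis by (simp add: f_def)
qed

lemma diag_mat_vec: "diag_mat d *v x = (\<chi> k. d k * x $ k)"
  by (simp add: diag_mat_def matrix_vector_mult_def vec_eq_iff if_distrib[of "\<lambda>a. a * _"]
      cong: if_cong)

lemma inner_transpose_vec: "(transpose Q *v x) \<bullet> y = x \<bullet> (Q *v y)" for Q :: "real^'m^'n"
  by (metis dot_lmul_matrix transpose_matrix_vector)

lemma orthogonal_projection_conj:
  fixes Q :: "real^'k^'n"
  assumes P: "orthogonal_projection P L"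
    and Q: "transpose Q ** Q = mat 1" "Q ** transpose Q = mat 1"
  shows "orthogonal_projection (\<lambda>x. transpose Q *v P (Q *v x)) ((*v) (transpose Q) ` L)"
proof (rule orthogonal_projection.intro)
  interpret orthogonal_projection P L by fact
  have QQ: "Q *v (transpose Q *v x) = x" for x
    by (simp add: matrix_vector_mul_assoc Q)
  show "linear (\<lambda>x. transpose Q *v P (Q *v x))"
    by (rule linearI)
       (simp_all add: matrix_vector_right_distrib matrix_vector_mult_scaleR
         linear_add[OF linear] linear_scale[OF linear])
  show "transpose Q *v P (Q *v x) \<in> (*v) (transpose Q) ` L" for x
    using range by blast
  show "(x - transpose Q *v P (Q *v x)) \<bullet> l = 0" if l: "l \<in> (*v) (transpose Q) ` L" for x l
  proof -
    obtain l' where l': "l' \<in> L" "l = transpose Q *v l'" using l by blast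
    have "x \<bullet> l = (Q *v x) \<bullet> l'"
      unfolding l'(2) by (metis inner_commute inner_transpose_vec)
    moreover have "(transpose Q *v P (Q *v x)) \<bullet> l = P (Q *v x) \<bullet> l'"
      by (simp add: inner_transpose_vec l'(2) QQ)
    ultimately show ?thesis using orth[OF l'(1), of "Q *v x"] by (simp add: inner_diff_left)
  qed
  show "transpose Q *v P (Q *v l) = l" if "l \<in> (*v) (transpose Q) ` L" for l
    using that by (auto simp: QQ id)
qed

text \<open>In the coordinates given by \<open>Q\<close> the energy never increases along the iteration.  This
  keeps the sequence in the ball on which the linear recursion is known to hold.\<close>

lemma linearised_iteration_converges:
  fixes M :: "real^'n^'n" and Q :: "real^('d::finite + 'm::finite)^'n"
  assumes M: "spectral_decomposition M Q \<Lambda>" and \<Lambda>: "\<And>i. 1 \<le> \<Lambda> $ i"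
    and P: "orthogonal_projection P L" and \<gamma>: "0 < \<gamma>" "\<gamma> < 1" and "r > 0"
  obtains \<epsilon> where "\<epsilon> > 0"
    "\<And>e. norm (e 0) \<le> \<epsilon> \<Longrightarrow>
      (\<And>j. norm (e j) < r \<Longrightarrow> e (Suc j) = e j - \<gamma> *\<^sub>R (W_mat Q \<Lambda> *v (M *v e j - P (e j)))) \<Longrightarrow>
      convergent e \<and> (\<forall>j. norm (e j) < r)"
proof -
  have Q: "transpose Q ** Q = mat 1" "Q ** transpose Q = mat 1"
    and Mdef: "M = Q ** diag_mat (M_diag \<Lambda>) ** transpose Q"
    using M by (auto simp: spectral_decomposition_def)
  have QQ: "Q *v (transpose Q *v x) = x" "transpose Q *v (Q *v y) = y" for x y
    by (simp_all add: matrix_vector_mul_assoc Q)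
  have norm_Q: "norm (transpose Q *v x) = norm x" for x
    by (simp add: norm_eq_sqrt_inner inner_transpose_vec QQ)
  define P' where "P' = (\<lambda>x. transpose Q *v P (Q *v x))"
  define B where "B = linear_step \<Lambda> P'"
  have P': "orthogonal_projection P' ((*v) (transpose Q) ` L)"
    unfolding P'_def by (rule orthogonal_projection_conj[OF P Q])
  have step: "transpose Q *v (W_mat Q \<Lambda> *v (M *v x - P x)) = B (transpose Q *v x)" for x
    by (simp add: B_def linear_step_def P'_def W_mat_def Mdef QQ diag_mat_vec vec_eq_iff
        matrix_vector_mul_assoc[symmetric] matrix_vector_mult_diff_distrib algebra_simps
        split: sum.split)
  define k where "k = \<gamma> * (1 - \<gamma>)"
  have "k > 0" using \<gamma> by (simp add: k_def)
  have averaged: "energy \<Lambda> (x - \<gamma> *\<^sub>R B x) \<le> energy \<Lambda> x - k * (norm (B x))\<^sup>2" for x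
  proof -
    have "energy \<Lambda> (x - \<gamma> *\<^sub>R B x) \<le> energy \<Lambda> x - k * energy \<Lambda> (B x)"
      unfolding k_def B_def using \<gamma> \<Lambda> by (intro linear_step_averaged[OF P']) auto
    moreover have "k * (norm (B x))\<^sup>2 \<le> k * energy \<Lambda> (B x)"
      using energy_ge_norm[OF \<Lambda>] \<open>k > 0\<close> by simp
    ultimately show ?thesis by linarith
  qed
  have "r\<^sup>2 > 0" using \<open>r > 0\<close> by simp
  then obtain d where "d > 0"
    and d0: "\<forall>x :: real^('d + 'm). x \<noteq> 0 \<and> norm (x - 0) < d \<longrightarrow>
      norm (energy \<Lambda> x - energy \<Lambda> (0 :: real^('d + 'm))) < r\<^sup>2"
    using isCont_energy[where \<Lambda> = \<Lambda> and e = "0 :: real^('d + 'm)", unfolded isCont_def LIM_eq]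
    by metis
  have d: "energy \<Lambda> x < r\<^sup>2" if "norm x < d" for x :: "real^('d + 'm)"
    using spec[OF d0, of x] that \<open>r\<^sup>2 > 0\<close> by (cases "x = 0") auto
  have conv: "convergent e \<and> (\<forall>j. norm (e j) < r)"
    if e0: "norm (e 0) \<le> d / 2"
      and e: "\<And>j. norm (e j) < r \<Longrightarrow> e (Suc j) = e j - \<gamma> *\<^sub>R (W_mat Q \<Lambda> *v (M *v e j - P (e j)))"
    for e
  proof -
    define a where "a j = transpose Q *v e j" for j
    have inside: "norm (e j) < r" if "energy \<Lambda> (a j) < r\<^sup>2" for j
    proof -
      have "(norm (e j))\<^sup>2 < r\<^sup>2"
        using energy_ge_norm[OF \<Lambda>, of "a j"] that by (simp add: a_def norm_Q)
      then show ?thesis using \<open>r > 0\<close> by (simp add: power_less_imp_less_base)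
    qed
    have a: "a (Suc j) = a j - \<gamma> *\<^sub>R B (a j)" if "norm (e j) < r" for j
      by (simp add: a_def e[OF that] step[symmetric] matrix_vector_mult_diff_distrib
          matrix_vector_mult_scaleR)
    have bound: "energy \<Lambda> (a j) < r\<^sup>2" for j
    proof (induction j)
      case 0
      show ?case using e0 \<open>d > 0\<close> by (intro d) (simp add: a_def norm_Q)
    next
      case (Suc j)
      have "energy \<Lambda> (a (Suc j)) \<le> energy \<Lambda> (a j)"
        using averaged[of "a j"] \<open>k > 0\<close> a[OF inside[OF Suc]]
        by (smt (verit) mult_nonneg_nonneg zero_le_power2)
      then show ?case using Suc by simp
    qed
    have "convergent a"
    proof (rule linear_Krasnoselskii_Mann[where c = 1 and q = "energy \<Lambda>"])
      show "linear B" unfolding B_def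
        using P' by (intro linear_linear_step) (simp add: orthogonal_projection_def)
      show "isCont (energy \<Lambda> :: real^('d + 'm) \<Rightarrow> real) 0" by (rule isCont_energy)
    qed (use \<open>k > 0\<close> averaged a inside bound energy_ge_norm[OF \<Lambda>] in auto)
    then obtain l where "a \<longlonglongrightarrow> l" by (auto simp: convergent_def)
    moreover have "isCont ((*v) Q) l"
      by (intro linear_continuous_at matrix_vector_mul_bounded_linear)
    ultimately have "(\<lambda>j. Q *v a j) \<longlonglongrightarrow> Q *v l"
      by (rule isCont_tendsto_compose[rotated])
    then have "e \<longlonglongrightarrow> Q *v l" by (simp add: a_def QQ)
    then show ?thesis using inside bound by (auto simp: convergent_def)
  qed
  show ?thesis
  proof (rule that)
    show "d / 2 > 0" using \<open>d > 0\<close> by simp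
  qed (rule conv)
qed

section \<open>Stationary points on the affine subspace\<close>

lemma positive_definite_inner_ge_0:
  "positive_definite H \<Longrightarrow> 0 \<le> x \<bullet> (H *v x)"
  by (cases "x = 0") (auto simp: positive_definite_def less_imp_le)

lemma positive_definite_inner_commute:
  assumes "positive_definite H"
  shows "x \<bullet> (H *v y) = y \<bullet> (H *v x)"
proof -
  have "x \<bullet> (H *v y) = (transpose H *v x) \<bullet> y" by (simp add: inner_transpose_vec)
  then show ?thesis using assms by (simp add: positive_definite_def inner_commute)
qed

lemma quad_objective_expand:
  assumes "positive_definite H"
  shows "quad_objective H h u
    = quad_objective H h z + (H *v z + h) \<bullet> (u - z) + 1/2 * ((u - z) \<bullet> (H *v (u - z)))"
  using positive_definite_inner_commute[OF assms, of z u]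
  by (simp add: quad_objective_def matrix_vector_mult_diff_distrib inner_diff inner_add
      inner_commute algebra_simps)

locale affine_quadratic =
  fixes H :: "real^'n^'n" and h :: "real^'n" and V :: "real^'d^'n" and vbar :: "real^'n"
    and E :: "(real^'n) set"
  assumes H: "positive_definite H"
    and V: "inj ((*v) V)"
    and E: "E = {V *v v + vbar | v. True}"
begin

abbreviation "R \<equiv> R_mat H V"

text \<open>For the fixed vector \<open>\<lambda> = \<xi> *\<^sub>R (z - s)\<close> this says that \<open>z\<close> minimises
  \<open>quad_objective H (h - \<lambda>)\<close> over \<open>E\<close>.
  Unlike \<open>M *v s + c = z\<close>, the formula makes sense for every \<open>\<xi>\<close>, also when \<open>\<xi> *\<^sub>R R - mat 1\<close> is
  singular.\<close>

definition stationary :: "real \<Rightarrow> real^'n \<Rightarrow> real^'n \<Rightarrow> bool" where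
  "stationary \<xi> z s \<longleftrightarrow> z = vbar + R *v (\<xi> *\<^sub>R (z - s) - h - H *v vbar)"

lemma inverse_reduced_Hessian:
  defines "K \<equiv> transpose V ** H ** V"
  shows "K ** matrix_inv K = mat 1" "matrix_inv K ** K = mat 1"
proof -
  have "v = 0" if "K *v v = 0" for v
  proof -
    have "(V *v v) \<bullet> (H *v (V *v v)) = v \<bullet> (K *v v)"
      by (simp add: K_def matrix_vector_mul_assoc[symmetric] inner_commute[of v] inner_transpose_vec
          inner_commute[of "H *v _"])
    then have "(V *v v) \<bullet> (H *v (V *v v)) = 0" using that by simp
    then have "V *v v = 0" using H unfolding positive_definite_def by (metis less_irrefl)
    then show "v = 0" using V by (metis injD matrix_vector_mult_0_right)
  qed
  then have "\<exists>B. B ** K = mat 1" by (simp add: matrix_left_invertible_ker)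
  then have "invertible K" by (metis invertible_left_inverse)
  then show "K ** matrix_inv K = mat 1" "matrix_inv K ** K = mat 1"
    unfolding matrix_inv_def invertible_def by (metis (mono_tags, lifting) someI_ex)+
qed

text \<open>The right-hand side is the first-order condition for minimising
  \<open>1/2 * ((z - vbar) \<bullet> (H *v (z - vbar))) - g \<bullet> z\<close> over \<open>E\<close>; in the parametrisation by \<open>V\<close> it
  is a linear system with the positive definite matrix \<open>transpose V ** H ** V\<close>.\<close>

lemma R_mult_iff:
  "z = vbar + R *v g \<longleftrightarrow> z \<in> E \<and> transpose V *v (H *v (z - vbar)) = transpose V *v g"
proof -
  define K where "K = transpose V ** H ** V"
  have K: "K *v (matrix_inv K *v x) = x" "matrix_inv K *v (K *v x) = x" for x
    using inverse_reduced_Hessian by (simp_all add: K_def matrix_vector_mul_assoc)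
  have R: "R *v g = V *v (matrix_inv K *v (transpose V *v g))"
    by (simp add: R_mat_def K_def matrix_vector_mul_assoc matrix_mul_assoc)
  have KV: "transpose V *v (H *v (V *v v)) = K *v v" for v
    by (simp add: K_def matrix_vector_mul_assoc matrix_mul_assoc)
  show ?thesis
  proof
    assume "z = vbar + R *v g"
    then show "z \<in> E \<and> transpose V *v (H *v (z - vbar)) = transpose V *v g"
      by (auto simp: R E KV K add.commute)
  next
    assume z: "z \<in> E \<and> transpose V *v (H *v (z - vbar)) = transpose V *v g"
    then obtain v where v: "z = V *v v + vbar" using E by blast
    then have "K *v v = transpose V *v g" using z by (simp add: KV)
    then have "v = matrix_inv K *v (transpose V *v g)" using K(2)[of v] by simp
    then show "z = vbar + R *v g" by (simp add: R v)
  qed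
qed

lemma stationary_zero_iff: "stationary \<xi> z z \<longleftrightarrow> z = z_circ H h V vbar"
proof -
  have "R *v (- h - H *v vbar) = - (R *v (h + H *v vbar))"
    using matrix_vector_mult_scaleR[of R "-1" "h + H *v vbar"] by simp
  then show ?thesis by (simp add: stationary_def z_circ_def)
qed

lemma stationary_in_E: "stationary \<xi> z s \<Longrightarrow> z \<in> E"
  by (simp add: stationary_def R_mult_iff)

lemma stationary_gradient:
  assumes "stationary \<xi> z s" "u \<in> E"
  shows "(H *v z + h) \<bullet> (u - z) = \<xi> * ((z - s) \<bullet> (u - z))"
proof -
  have z: "z \<in> E" "transpose V *v (H *v (z - vbar))
      = transpose V *v (\<xi> *\<^sub>R (z - s) - h - H *v vbar)"
    using assms(1) unfolding stationary_def R_mult_iff by blast+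
  obtain v where "u - z = V *v v"
    using assms(2) z(1) unfolding E
    by (auto simp: matrix_vector_mult_diff_distrib[symmetric])
  then have "(H *v (z - vbar)) \<bullet> (u - z) = (\<xi> *\<^sub>R (z - s) - h - H *v vbar) \<bullet> (u - z)"
    using z(2) by (metis inner_transpose_vec)
  then show ?thesis
    by (simp add: matrix_vector_mult_diff_distrib inner_diff_left inner_add_left)
qed

lemma convex_E: "convex E"
proof -
  have "E = (\<lambda>x. x + vbar) ` range ((*v) V)" unfolding E by auto
  moreover have "convex (range ((*v) V))"
    by (intro convex_linear_image matrix_vector_mul_linear convex_UNIV)
  ultimately show ?thesis by (metis convex_translation_eq add.commute image_cong)
qed

lemma regular_normal_cone_E:
  assumes "z \<in> E"
  shows "\<nu> \<in> regular_normal_cone E z \<longleftrightarrow> transpose V *v \<nu> = 0"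
proof
  assume \<nu>: "\<nu> \<in> regular_normal_cone E z"
  have "convex E"
    by (rule convex_E)
  have "\<nu> \<bullet> (V *v v) \<le> 0" for v
  proof -
    obtain v0 where "z = V *v v0 + vbar" using assms E by blast
    then have "z + V *v v = V *v (v0 + v) + vbar" by (simp add: matrix_vector_right_distrib)
    then have "z + V *v v \<in> E" unfolding E by blast
    from regular_normal_cone_convex[OF \<nu> \<open>convex E\<close> subset_refl assms this]
    show ?thesis by simp
  qed
  then have "(transpose V *v \<nu>) \<bullet> (transpose V *v \<nu>) \<le> 0"
    by (simp add: inner_transpose_vec)
  then show "transpose V *v \<nu> = 0" by (metis inner_eq_zero_iff inner_ge_zero order_antisym)
next
  assume \<nu>: "transpose V *v \<nu> = 0"
  show "\<nu> \<in> regular_normal_cone E z"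
  proof (rule proximal_in_regular_normal_cone[where K = 0, OF assms])
    fix u assume "u \<in> E"
    then obtain v where "u - z = V *v v"
      using assms unfolding E by (auto simp: matrix_vector_mult_diff_distrib[symmetric])
    then have "\<nu> \<bullet> (u - z) = 0" using \<nu> by (metis inner_transpose_vec inner_zero_left)
    then show "\<nu> \<bullet> (u - z) \<le> 0 * ((u - z) \<bullet> (u - z))" by simp
  qed
qed

lemma F_set_iff:
  assumes "\<xi> \<noteq> 0"
  shows "s \<in> F_set H h E Z \<xi> z \<longleftrightarrow> stationary \<xi> z s \<and> z \<in> proj_set Z s"
proof -
  let ?l = "\<xi> *\<^sub>R (z - s)"
  have "(\<exists>\<nu>\<in>regular_normal_cone E z. 0 = H *v z + h + \<nu> - ?l)
      \<longleftrightarrow> ?l - h - H *v z \<in> regular_normal_cone E z"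
  proof -
    have "0 = H *v z + h + \<nu> - ?l \<longleftrightarrow> \<nu> = ?l - h - H *v z" for \<nu>
      by (auto simp: algebra_simps)
    then show ?thesis by simp
  qed
  also have "\<dots> \<longleftrightarrow> z \<in> E \<and> transpose V *v (?l - h - H *v z) = 0"
    using regular_normal_cone_E by (auto simp: regular_normal_cone_def split: if_splits)
  also have "\<dots> \<longleftrightarrow> stationary \<xi> z s"
    unfolding stationary_def R_mult_iff
    by (simp add: matrix_vector_mult_diff_distrib) (auto simp: algebra_simps)
  finally show ?thesis
    using assms by (simp add: F_set_def proximal_KKT_point_def)
qed

lemma R_quadratic: "(R *v x) \<bullet> (H *v (R *v x)) = (R *v x) \<bullet> x"
proof -
  define y where "y = R *v x"
  have "vbar + y \<in> E" and Vy: "transpose V *v (H *v y) = transpose V *v x"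
    using R_mult_iff[of "vbar + y" x] by (simp_all add: y_def)
  then obtain v where "y = V *v v" using E by (auto simp: add.commute)
  then show ?thesis
    using Vy by (fold y_def) (metis inner_commute inner_transpose_vec)
qed

lemma R_eigenvalue:
  assumes "R *v x = \<rho> *\<^sub>R x" "x \<noteq> 0" "\<rho> \<noteq> 0"
  shows "0 < \<rho>" "\<rho> * (x \<bullet> (H *v x)) = x \<bullet> x"
proof -
  have "\<rho> * (\<rho> * (x \<bullet> (H *v x))) = \<rho> * (x \<bullet> x)"
    using R_quadratic[of x] by (simp add: assms(1) matrix_vector_mult_scaleR)
  then show eq: "\<rho> * (x \<bullet> (H *v x)) = x \<bullet> x" using assms(3) by simp
  have "0 < x \<bullet> (H *v x)" using H assms(2) by (simp add: positive_definite_def)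
  moreover have "0 < \<rho> * (x \<bullet> (H *v x))" using eq assms(2) by simp
  ultimately show "0 < \<rho>" by (simp add: zero_less_mult_iff)
qed

text \<open>Nonzero eigenvalues of \<open>R\<close> are at least \<open>1 / C\<close>, so \<open>1 / \<xi>\<close> is not one of them.\<close>

lemma shifted_R_invertible:
  assumes C: "\<And>x. x \<bullet> (H *v x) \<le> C * (x \<bullet> x)" and \<xi>: "0 < \<xi>" "C < \<xi>"
  defines "G \<equiv> \<xi> *\<^sub>R R - mat 1"
  shows "G ** matrix_inv G = mat 1" "matrix_inv G ** G = mat 1"
proof -
  have "x = 0" if "G *v x = 0" for x
  proof (rule ccontr)
    assume "x \<noteq> 0"
    have "\<xi> *\<^sub>R (R *v x) = x"
      using that by (simp add: G_def matrix_vector_mult_diff_rdistrib scaleR_matrix_vector_assoc)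
    then have "R *v x = (1 / \<xi>) *\<^sub>R x" using \<xi>(1) by (metis divideR_right less_irrefl
          scaleR_one times_divide_eq_left mult_1 inverse_eq_divide)
    then have "1 / \<xi> * (x \<bullet> (H *v x)) = x \<bullet> x"
      using \<open>x \<noteq> 0\<close> \<xi>(1) by (intro R_eigenvalue(2)) auto
    then have "\<xi> * (x \<bullet> x) \<le> C * (x \<bullet> x)" using C[of x] \<xi>(1) by (simp add: field_simps)
    then show False using \<xi>(2) \<open>x \<noteq> 0\<close> by (simp add: mult_le_cancel_right)
  qed
  then have "\<exists>B. B ** G = mat 1" by (simp add: matrix_left_invertible_ker)
  then have "invertible G" by (metis invertible_left_inverse)
  then show "G ** matrix_inv G = mat 1" "matrix_inv G ** G = mat 1"
    unfolding matrix_inv_def invertible_def by (metis (mono_tags, lifting) someI_ex)+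
qed

text \<open>Collecting the terms with \<open>z\<close>, the equation of \<open>stationary\<close> reads
  \<open>(\<xi> *\<^sub>R R - mat 1) *v z = \<xi> *\<^sub>R (R *v s) + R *v (h + H *v vbar) - vbar\<close>.\<close>

lemma M_c_eq_iff_stationary:
  assumes "\<And>x. x \<bullet> (H *v x) \<le> C * (x \<bullet> x)" "0 < \<xi>" "C < \<xi>"
  shows "M_mat H V \<xi> *v s + c_vec H h V vbar \<xi> = z \<longleftrightarrow> stationary \<xi> z s"
proof -
  define G where "G = \<xi> *\<^sub>R R - mat 1"
  have G: "G *v (matrix_inv G *v x) = x" "matrix_inv G *v (G *v x) = x" for x
    using shifted_R_invertible[OF assms] by (simp_all add: G_def matrix_vector_mul_assoc)
  have "M_mat H V \<xi> *v s + c_vec H h V vbar \<xi>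
      = matrix_inv G *v (\<xi> *\<^sub>R (R *v s) + R *v (h + H *v vbar) - vbar)"
    by (simp add: M_mat_def c_vec_def G_def[symmetric] matrix_vector_mul_assoc[symmetric]
        scaleR_matrix_vector_assoc[symmetric] matrix_vector_mult_scaleR
        matrix_vector_mult_diff_distrib matrix_vector_right_distrib)
  also have "\<dots> = z \<longleftrightarrow> \<xi> *\<^sub>R (R *v s) + R *v (h + H *v vbar) - vbar = G *v z"
    by (metis G)
  also have "G *v z = \<xi> *\<^sub>R (R *v z) - z"
    by (simp add: G_def matrix_vector_mult_diff_rdistrib scaleR_matrix_vector_assoc)
  also have "\<xi> *\<^sub>R (R *v s) + R *v (h + H *v vbar) - vbar = \<dots> \<longleftrightarrow> stationary \<xi> z s"
    by (simp add: stationary_def matrix_vector_mult_diff_distrib matrix_vector_right_distrib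
        matrix_vector_mult_scaleR algebra_simps)
  finally show ?thesis .
qed

text \<open>An eigenvector of \<open>M\<close> for \<open>\<Lambda> $ i\<close> is one of \<open>R\<close> for some \<open>\<rho> > 0\<close>, and
  \<open>\<Lambda> $ i = \<xi> * \<rho> / (\<xi> * \<rho> - 1)\<close>, which exceeds \<open>1\<close> whenever it is positive.\<close>

lemma spectral_decomposition_ge_1:
  fixes Q :: "real^('d + 'm::finite)^'n"
  assumes C: "\<And>x. x \<bullet> (H *v x) \<le> C * (x \<bullet> x)" "0 < \<xi>" "C < \<xi>"
    and Q: "spectral_decomposition (M_mat H V \<xi>) Q \<Lambda>"
  shows "1 \<le> \<Lambda> $ i"
proof -
  define M where "M = M_mat H V \<xi>"
  define G where "G = \<xi> *\<^sub>R R - mat 1"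
  have QQ: "transpose Q ** Q = mat 1" and pos: "0 < \<Lambda> $ i"
    and M: "M = Q ** diag_mat (M_diag \<Lambda>) ** transpose Q"
    using Q by (auto simp: spectral_decomposition_def M_def)
  define a :: "real^('d + 'm)" where "a = axis (Inl i) 1"
  define x where "x = Q *v a"
  have Qx: "transpose Q *v x = a" by (simp add: x_def matrix_vector_mul_assoc QQ)
  then have "x \<noteq> 0" by (auto simp: a_def axis_eq_0_iff)
  have "diag_mat (M_diag \<Lambda>) *v a = \<Lambda> $ i *\<^sub>R a"
    by (auto simp: diag_mat_vec vec_eq_iff a_def axis_def)
  then have Mx: "M *v x = \<Lambda> $ i *\<^sub>R x"
    unfolding M by (simp add: matrix_vector_mul_assoc[symmetric] Qx matrix_vector_mult_scaleR)
      (simp add: x_def)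
  have "G *v (matrix_inv G *v y) = y" for y
    using shifted_R_invertible[OF C] by (simp add: G_def matrix_vector_mul_assoc)
  then have "G *v (M *v x) = \<xi> *\<^sub>R (R *v x)"
    by (simp add: M_def M_mat_def G_def[symmetric] matrix_vector_mul_assoc[symmetric]
        scaleR_matrix_vector_assoc[symmetric] matrix_vector_mult_scaleR)
  then have "\<xi> *\<^sub>R (R *v x) = \<Lambda> $ i *\<^sub>R (\<xi> *\<^sub>R (R *v x) - x)"
    by (simp add: Mx matrix_vector_mult_scaleR G_def matrix_vector_mult_diff_rdistrib
        scaleR_matrix_vector_assoc)
  then have eq: "((\<Lambda> $ i - 1) * \<xi>) *\<^sub>R (R *v x) = \<Lambda> $ i *\<^sub>R x"
    by (simp add: algebra_simps)
  have ne: "(\<Lambda> $ i - 1) * \<xi> \<noteq> 0" using eq pos \<open>x \<noteq> 0\<close> by auto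
  have "R *v x = (\<Lambda> $ i / ((\<Lambda> $ i - 1) * \<xi>)) *\<^sub>R x"
    using arg_cong[OF eq, of "\<lambda>v. (1 / ((\<Lambda> $ i - 1) * \<xi>)) *\<^sub>R v"] ne by simp
  then have "0 < \<Lambda> $ i / ((\<Lambda> $ i - 1) * \<xi>)"
    using pos ne \<open>x \<noteq> 0\<close> by (intro R_eigenvalue(1)) auto
  then have "0 < \<Lambda> $ i - 1" using pos C(2) by (simp add: zero_less_divide_iff zero_less_mult_iff)
  then show ?thesis by simp
qed

section \<open>Local minima\<close>

text \<open>On every polyhedron through \<open>z\<close> the first-order term of the objective along \<open>E\<close> is
  \<open>\<xi> * ((z - s) \<bullet> (u - z))\<close>, which is nonnegative because \<open>s - z\<close> is a normal.\<close>

lemma stationary_projection_imp_local_minimum: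
  assumes "finite \<P>" "\<And>S. S \<in> \<P> \<Longrightarrow> polyhedron S" "Z = \<Union>\<P>" "0 < \<xi>"
    and st: "stationary \<xi> z s" and pr: "z \<in> proj_set Z s"
  shows "local_minimum (quad_objective H h) (E \<inter> Z) z"
proof -
  have "z \<in> E \<inter> Z" using stationary_in_E[OF st] pr by (simp add: proj_set_iff)
  moreover obtain d where "d > 0"
    and d: "\<And>S u. S \<in> \<P> \<Longrightarrow> u \<in> S \<Longrightarrow> dist u z < d \<Longrightarrow> z \<in> S"
    using only_active_pieces_nearby[OF assms(1) polyhedron_imp_closed[OF assms(2)]] by metis
  moreover have "quad_objective H h z \<le> quad_objective H h u"
    if u: "u \<in> E" "u \<in> Z" "dist z u \<le> d / 2" for u
  proof -
    obtain S where S: "S \<in> \<P>" "u \<in> S" using u(2) assms(3) by blast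
    then have "z \<in> S" using d[OF S] u(3) \<open>d > 0\<close> by (simp add: dist_commute)
    have "(s - z) \<bullet> (u - z) \<le> 0"
      using S assms(3) \<open>z \<in> S\<close> polyhedron_imp_convex[OF assms(2)[OF S(1)]]
      by (intro regular_normal_cone_convex[OF proj_set_imp_regular_normal[OF pr]]) auto
    then have "0 \<le> \<xi> * ((z - s) \<bullet> (u - z))"
      using \<open>0 < \<xi>\<close> by (simp add: inner_diff_left)
    then show ?thesis
      using quad_objective_expand[OF H, of h u z] stationary_gradient[OF st u(1)]
        positive_definite_inner_ge_0[OF H, of "u - z"] by linarith
  qed
  ultimately show ?thesis
    unfolding local_minimum_def by (intro conjI exI[of _ "d / 2"]) auto
qed

text \<open>Otherwise a short step from \<open>z\<close> towards \<open>u\<close> would decrease the objective: for step length \<open>t\<close>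
  the first-order term is of order \<open>t\<close>, the second-order term of order \<open>t\<^sup>2\<close>.\<close>

lemma local_minimum_directional:
  assumes lm: "local_minimum (quad_objective H h) C z"
    and S: "convex S" "S \<subseteq> C" "z \<in> S" "u \<in> S"
  shows "0 \<le> (H *v z + h) \<bullet> (u - z)"
proof (rule ccontr)
  define g where "g = (H *v z + h) \<bullet> (u - z)"
  define k where "k = (u - z) \<bullet> (H *v (u - z))"
  assume "\<not> 0 \<le> (H *v z + h) \<bullet> (u - z)"
  then have "g < 0" by (simp add: g_def)
  have "k \<ge> 0" unfolding k_def by (rule positive_definite_inner_ge_0[OF H])
  obtain r where "r > 0" and r: "\<And>u. u \<in> C \<Longrightarrow> dist z u \<le> r \<Longrightarrow>
      quad_objective H h z \<le> quad_objective H h u"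
    using lm by (auto simp: local_minimum_def)
  \<comment> \<open>The second bound keeps the step within the radius \<open>r\<close>, the third one lets the linear term
    dominate the quadratic one.\<close>
  define t where "t = min 1 (min (r / (norm (u - z) + 1)) (- g / (k + 1)))"
  have n1: "0 < norm (u - z) + 1" by (smt (verit) norm_ge_zero)
  have t: "0 < t" "t \<le> 1" using \<open>r > 0\<close> \<open>g < 0\<close> \<open>k \<ge> 0\<close> n1 by (auto simp: t_def divide_neg_pos)
  define v where "v = z + t *\<^sub>R (u - z)"
  have "v = (1 - t) *\<^sub>R z + t *\<^sub>R u" by (simp add: v_def algebra_simps)
  then have "v \<in> C" using S t convexD_alt[of S z u t] by auto
  moreover have "dist z v \<le> r"
  proof -
    have "t * norm (u - z) \<le> r / (norm (u - z) + 1) * (norm (u - z) + 1)"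
      using t(1) n1 \<open>r > 0\<close> by (intro mult_mono) (auto simp: t_def)
    then show ?thesis using t(1) n1 by (simp add: v_def dist_norm)
  qed
  ultimately have "quad_objective H h z \<le> quad_objective H h v" by (rule r)
  then have "0 \<le> t * g + 1/2 * (t * (t * k))"
    using quad_objective_expand[OF H, of h v z]
    by (simp add: v_def g_def k_def matrix_vector_mult_scaleR)
  then have "0 \<le> t * (g + 1/2 * (t * k))" by (simp add: algebra_simps)
  then have "0 \<le> g + 1/2 * (t * k)" using t(1) by (simp add: zero_le_mult_iff)
  moreover have "t * k \<le> - g"
  proof -
    have "t * k \<le> - g / (k + 1) * (k + 1)"
      using \<open>k \<ge> 0\<close> \<open>g < 0\<close> t(1) by (intro mult_mono) (auto simp: t_def)
    then show ?thesis using \<open>k \<ge> 0\<close> by simp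
  qed
  ultimately show False using \<open>g < 0\<close> by linarith
qed

text \<open>By strict convexity every set of \<open>\<P>\<close> contains at most one local minimum.\<close>

lemma finite_local_minima:
  assumes "finite \<P>" "\<And>S. S \<in> \<P> \<Longrightarrow> convex S" "Z = \<Union>\<P>"
  shows "finite {z. local_minimum (quad_objective H h) (E \<inter> Z) z}" (is "finite ?L")
proof -
  have inZ: "z \<in> E" "z \<in> Z" if "z \<in> ?L" for z using that by (auto simp: local_minimum_def)
  have "\<forall>z\<in>?L. \<exists>S. S \<in> \<P> \<and> z \<in> S" using inZ(2) assms(3) by blast
  from bchoice[OF this] obtain piece where piece: "\<forall>z\<in>?L. piece z \<in> \<P> \<and> z \<in> piece z" ..
  have "inj_on piece ?L"
  proof (rule inj_onI)
    fix x y assume xy: "x \<in> ?L" "y \<in> ?L" "piece x = piece y"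
    define S where "S = E \<inter> piece x"
    have S: "convex S" "S \<subseteq> E \<inter> Z" "x \<in> S" "y \<in> S"
      using piece xy assms inZ convex_E unfolding S_def by (auto intro: convex_Int)
    have "0 \<le> (H *v x + h) \<bullet> (y - x)" "0 \<le> (H *v y + h) \<bullet> (x - y)"
      using local_minimum_directional S xy by blast+
    then have "(y - x) \<bullet> (H *v (y - x)) \<le> 0"
      by (simp add: matrix_vector_mult_diff_distrib inner_diff inner_add inner_commute)
    then show "x = y"
      using H unfolding positive_definite_def by (metis eq_iff_diff_eq_0 not_less)
  qed
  moreover have "finite (piece ` ?L)" using piece assms(1) by (auto intro: finite_subset)
  ultimately show ?thesis by (rule finite_imageD[rotated])
qed

end

section \<open>Relative frontiers of closed convex sets are null sets\<close>

lemma lborel_real_affine_vimage: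
  fixes c t :: real
  assumes "0 < t" "A \<in> sets borel"
  shows "emeasure lborel A = ennreal t * emeasure lborel ((\<lambda>x. c + t * x) -` A)"
proof -
  have "emeasure lborel A
      = emeasure (density (distr lborel borel (\<lambda>x. c + t * x)) (\<lambda>_. ennreal \<bar>t\<bar>)) A"
    using lborel_real_affine[of t c] assms(1) by simp
  then show ?thesis using assms by (simp add: emeasure_density emeasure_distr nn_integral_cmult)
qed

lemma product_lborel_homothety:
  fixes B :: "'b set" and f0 :: "'b \<Rightarrow> real"
  assumes "finite B" "0 < t" "A \<in> sets (\<Pi>\<^sub>M b\<in>B. lborel)"
  defines "\<sigma> \<equiv> \<lambda>f. \<lambda>b\<in>B. f0 b + t * (f b - f0 b)"
  shows "\<sigma> \<in> measurable (\<Pi>\<^sub>M b\<in>B. lborel) (\<Pi>\<^sub>M b\<in>B. lborel)"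
    and "emeasure (\<Pi>\<^sub>M b\<in>B. lborel) A = ennreal (t ^ card B)
      * emeasure (\<Pi>\<^sub>M b\<in>B. lborel) (\<sigma> -` A \<inter> space (\<Pi>\<^sub>M b\<in>B. lborel))"
proof -
  interpret product_sigma_finite "\<lambda>b :: 'b. lborel :: real measure" ..
  define N where "N = (\<Pi>\<^sub>M b\<in>B. lborel :: real measure)"
  have \<sigma>: "\<sigma> \<in> measurable N N" unfolding N_def \<sigma>_def by measurable
  then show "\<sigma> \<in> measurable (\<Pi>\<^sub>M b\<in>B. lborel) (\<Pi>\<^sub>M b\<in>B. lborel)" by (simp add: N_def)
  have "scale_measure (ennreal (t ^ card B)) (distr N N \<sigma>) = N"
    unfolding N_def
  proof (rule PiM_eqI)
    fix C :: "'b \<Rightarrow> real set" assume C: "\<And>b. b \<in> B \<Longrightarrow> C b \<in> sets lborel"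
    define D where "D b = (\<lambda>x. (f0 b - t * f0 b) + t * x) -` C b" for b
    have D: "D b \<in> sets lborel" if "b \<in> B" for b
    proof -
      have "(\<lambda>x. (f0 b - t * f0 b) + t * x) \<in> borel_measurable borel" by simp
      from measurable_sets[OF this, of "C b"] show ?thesis
        using C[OF that] by (simp add: D_def)
    qed
    have "\<sigma> -` Pi\<^sub>E B C \<inter> space N = Pi\<^sub>E B D"
      by (auto simp: \<sigma>_def D_def N_def space_PiM PiE_iff algebra_simps)
    then have "emeasure (distr N N \<sigma>) (Pi\<^sub>E B C) = emeasure N (Pi\<^sub>E B D)"
      using C \<open>finite B\<close> \<sigma> by (subst emeasure_distr) (auto simp: N_def intro!: sets_PiM_I_finite)
    also have "\<dots> = (\<Prod>b\<in>B. emeasure lborel (D b))"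
      unfolding N_def using D \<open>finite B\<close> by (subst emeasure_PiM) auto
    finally have "emeasure (scale_measure (ennreal (t ^ card B)) (distr N N \<sigma>)) (Pi\<^sub>E B C)
        = (\<Prod>b\<in>B. ennreal t * emeasure lborel (D b))"
      using \<open>0 < t\<close> by (simp add: prod.distrib ennreal_power)
    also have "\<dots> = (\<Prod>b\<in>B. emeasure lborel (C b))"
      unfolding D_def using C \<open>0 < t\<close>
      by (intro prod.cong refl lborel_real_affine_vimage[symmetric]) auto
    finally show "emeasure (scale_measure (ennreal (t ^ card B))
        (distr (\<Pi>\<^sub>M b\<in>B. lborel) (\<Pi>\<^sub>M b\<in>B. lborel) \<sigma>)) (Pi\<^sub>E B C)
        = (\<Prod>b\<in>B. emeasure lborel (C b))" by (simp add: N_def)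
  qed (use \<open>finite B\<close> in auto)
  then have "emeasure N A = emeasure (scale_measure (ennreal (t ^ card B)) (distr N N \<sigma>)) A"
    by simp
  also have "\<dots> = ennreal (t ^ card B) * emeasure N (\<sigma> -` A \<inter> space N)"
    using assms(3) \<sigma> by (simp add: emeasure_distr N_def)
  finally show "emeasure (\<Pi>\<^sub>M b\<in>B. lborel) A = ennreal (t ^ card B)
      * emeasure (\<Pi>\<^sub>M b\<in>B. lborel) (\<sigma> -` A \<inter> space (\<Pi>\<^sub>M b\<in>B. lborel))"
    by (simp add: N_def)
qed

text \<open>If two homothetic copies \<open>p + t * (X - p)\<close> of different ratios met, then \<open>X\<close> would contain a
  point strictly between \<open>p\<close> and another of its points.  So infinitely many disjoint copies of
  measure at least \<open>(1/2)^k * \<mu> X\<close> fit into a ball of finite measure.\<close>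

lemma null_of_disjoint_homotheties:
  fixes p :: "'a::euclidean_space" and \<mu> :: "'a measure"
  assumes \<mu>: "sets \<mu> = sets borel" "emeasure \<mu> (cball p \<rho>) < \<infinity>"
    and hom: "\<And>t A. 0 < t \<Longrightarrow> compact A \<Longrightarrow>
      emeasure \<mu> ((\<lambda>x. p + t *\<^sub>R (x - p)) ` A) = ennreal (t ^ k) * emeasure \<mu> A"
    and X: "compact X" "X \<subseteq> cball p \<rho>"
    and disj: "\<And>x t. x \<in> X \<Longrightarrow> 0 < t \<Longrightarrow> t < 1 \<Longrightarrow> p + t *\<^sub>R (x - p) \<notin> X"
  shows "emeasure \<mu> X = 0"
proof -
  \<comment> \<open>Any sequence of distinct ratios in \<open>[1/2, 1)\<close> would do.\<close>
  define \<tau> where "\<tau> n = 1 - 1 / (real n + 2)" for n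
  have \<tau>: "1/2 \<le> \<tau> n" "\<tau> n < 1" for n by (auto simp: \<tau>_def field_simps)
  have \<tau>_less: "\<tau> m < \<tau> n" if "m < n" for m n using that by (simp add: \<tau>_def frac_less2)
  define Y where "Y n = (\<lambda>x. p + \<tau> n *\<^sub>R (x - p)) ` X" for n
  have "compact (Y n)" for n
    unfolding Y_def by (intro compact_continuous_image X continuous_intros)
  then have Y: "Y n \<in> sets \<mu>" for n by (simp add: \<mu>(1) borel_compact)
  have sub: "Y n \<subseteq> cball p \<rho>" for n
  proof
    fix y assume "y \<in> Y n"
    then obtain x where x: "x \<in> X" "y = p + \<tau> n *\<^sub>R (x - p)" by (auto simp: Y_def)
    have "dist p y = \<tau> n * norm (x - p)" using \<tau>[of n] by (simp add: x dist_norm)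
    also have "\<dots> \<le> 1 * norm (x - p)" using \<tau>[of n] by (intro mult_right_mono) auto
    also have "\<dots> \<le> \<rho>" using x X by (auto simp: dist_norm norm_minus_commute)
    finally show "y \<in> cball p \<rho>" by simp
  qed
  have less: "Y m \<inter> Y n = {}" if "m < n" for m n
  proof (rule ccontr)
    assume "Y m \<inter> Y n \<noteq> {}"
    then obtain x y where xy: "x \<in> X" "y \<in> X" "\<tau> m *\<^sub>R (x - p) = \<tau> n *\<^sub>R (y - p)"
      by (auto simp: Y_def)
    have "\<tau> n > 0" using \<tau>(1)[of n] by linarith
    then have "y - p = (1 / \<tau> n) *\<^sub>R (\<tau> n *\<^sub>R (y - p))" by simp
    then have "y - p = (\<tau> m / \<tau> n) *\<^sub>R (x - p)" by (simp add: xy(3)[symmetric])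
    then have "y = p + (\<tau> m / \<tau> n) *\<^sub>R (x - p)" by (simp add: algebra_simps)
    moreover have "0 < \<tau> m / \<tau> n" "\<tau> m / \<tau> n < 1"
      using \<tau>(1)[of m] \<tau>(1)[of n] \<tau>_less[OF that] by auto
    ultimately show False using disj xy by metis
  qed
  have "disjoint_family Y"
    unfolding disjoint_family_on_def using less by (metis inf_commute linorder_neqE_nat)
  define c where "c = ennreal ((1/2) ^ k) * emeasure \<mu> X"
  have cY: "c \<le> emeasure \<mu> (Y n)" for n
  proof -
    have "emeasure \<mu> (Y n) = ennreal (\<tau> n ^ k) * emeasure \<mu> X"
      unfolding Y_def using \<tau>(1)[of n] X(1) by (intro hom) auto
    moreover have "ennreal ((1/2) ^ k) \<le> ennreal (\<tau> n ^ k)"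
      using \<tau>(1)[of n] by (intro ennreal_leI power_mono) auto
    ultimately show ?thesis unfolding c_def by (simp add: mult_right_mono)
  qed
  have total: "of_nat m * c \<le> emeasure \<mu> (cball p \<rho>)" for m
  proof -
    have "of_nat m * c \<le> (\<Sum>n<m. emeasure \<mu> (Y n))"
      using sum_mono[of "{..<m}" "\<lambda>_. c"] cY by simp
    also have "\<dots> = emeasure \<mu> (\<Union>n<m. Y n)"
      using Y \<open>disjoint_family Y\<close>
      by (intro sum_emeasure) (auto intro: disjoint_family_on_mono)
    also have "\<dots> \<le> emeasure \<mu> (cball p \<rho>)" using sub \<mu>(1) by (intro emeasure_mono) auto
    finally show ?thesis .
  qed
  obtain K where K: "K \<ge> 0" "emeasure \<mu> (cball p \<rho>) = ennreal K"
    using \<mu>(2) by (cases "emeasure \<mu> (cball p \<rho>)") auto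
  have "c \<le> ennreal K" using total[of 1] K by simp
  then obtain c' where c': "c' \<ge> 0" "c = ennreal c'"
    by (cases c) (auto simp: top_unique)
  have "real m * c' \<le> K" for m
    using total[of m] K c' by (simp add: ennreal_of_nat_eq_real_of_nat flip: ennreal_mult'')
  then have "c' \<le> 0" by (meson ex_less_of_nat_mult not_le)
  then have "c = 0" using c' by (simp add: ennreal_eq_0_iff)
  then show ?thesis by (simp add: c_def)
qed

lemma subspace_differences_of_affine:
  assumes "affine L" "L \<noteq> {}"
  shows "subspace {x - y | x y. x \<in> L \<and> y \<in> L}"
proof -
  obtain a where "a \<in> L" using assms(2) by blast
  have "{x - y | x y. x \<in> L \<and> y \<in> L} = (\<lambda>x. - a + x) ` L"
  proof (intro equalityI subsetI)
    fix d assume "d \<in> {x - y | x y. x \<in> L \<and> y \<in> L}"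
    then obtain x y where "x \<in> L" "y \<in> L" "d = x - y" by blast
    then have "a + 1 *\<^sub>R (x - y) \<in> L"
      using mem_affine_3_minus[OF assms(1) \<open>a \<in> L\<close>] by blast
    then show "d \<in> (\<lambda>x. - a + x) ` L"
      using \<open>d = x - y\<close> by (intro image_eqI[of _ _ "a + (x - y)"]) auto
  next
    fix d assume "d \<in> (\<lambda>x. - a + x) ` L"
    then obtain x where "x \<in> L" "d = x - a" by auto
    then show "d \<in> {x - y | x y. x \<in> L \<and> y \<in> L}" using \<open>a \<in> L\<close> by blast
  qed
  then show ?thesis using affine_diffs_subspace[OF assms(1) \<open>a \<in> L\<close>] by simp
qed

lemma affine_lebesgue_parametrization:
  assumes "affine L" "L \<noteq> {}"
  obtains a B where "finite B" "pairwise orthogonal B" "\<And>b. b \<in> B \<Longrightarrow> norm b = 1"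
    "L = (\<lambda>f. a + (\<Sum>b\<in>B. f b *\<^sub>R b)) ` UNIV"
    "affine_lebesgue L =
      completion (distr (\<Pi>\<^sub>M b\<in>B. lborel) borel (\<lambda>f. a + (\<Sum>b\<in>B. f b *\<^sub>R b)))"
proof
  define a where "a = (SOME a. a \<in> L)"
  define D where "D = {x - y | x y. x \<in> L \<and> y \<in> L}"
  define B where "B = (SOME B. pairwise orthogonal B \<and> (\<forall>b\<in>B. norm b = 1) \<and> span B = D)"
  have "a \<in> L" unfolding a_def using assms(2) by (simp add: some_in_eq)
  have "subspace D" unfolding D_def by (rule subspace_differences_of_affine[OF assms])
  then have "\<exists>B. pairwise orthogonal B \<and> (\<forall>b\<in>B. norm b = 1) \<and> span B = D"
    by (metis orthonormal_basis_subspace)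
  then have B: "pairwise orthogonal B \<and> (\<forall>b\<in>B. norm b = 1) \<and> span B = D"
    unfolding B_def by (rule someI_ex)
  then have "independent B" by (intro pairwise_orthogonal_independent) auto
  then show "finite B" by (rule independent_imp_finite)
  show "pairwise orthogonal B" "\<And>b. b \<in> B \<Longrightarrow> norm b = 1" using B by auto
  have "L = (\<lambda>d. a + d) ` D"
  proof (intro equalityI subsetI)
    fix x assume "x \<in> L"
    then have "x - a \<in> D" using \<open>a \<in> L\<close> by (auto simp: D_def)
    then show "x \<in> (\<lambda>d. a + d) ` D" by (rule image_eqI[rotated]) simp
  next
    fix x assume "x \<in> (\<lambda>d. a + d) ` D"
    then obtain y z where "y \<in> L" "z \<in> L" "x = a + 1 *\<^sub>R (y - z)" by (auto simp: D_def)
    then show "x \<in> L" using mem_affine_3_minus[OF assms(1) \<open>a \<in> L\<close>] by blast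
  qed
  also have "D = range (\<lambda>f. \<Sum>b\<in>B. f b *\<^sub>R b)" using B span_finite[OF \<open>finite B\<close>] by simp
  finally show "L = (\<lambda>f. a + (\<Sum>b\<in>B. f b *\<^sub>R b)) ` UNIV" by (simp add: image_image)
  show "affine_lebesgue L =
      completion (distr (\<Pi>\<^sub>M b\<in>B. lborel) borel (\<lambda>f. a + (\<Sum>b\<in>B. f b *\<^sub>R b)))"
    by (simp add: affine_lebesgue_def Let_def a_def B_def D_def)
qed

text \<open>In an orthonormal parametrisation of the affine hull, homotheties about a relative interior
  point \<open>p\<close> scale the measure by \<open>t ^ card B\<close> and balls have finite measure; so every bounded
  part of the relative frontier is null.\<close>

lemma convex_rel_frontier_null:
  fixes F :: "'a::euclidean_space set"
  assumes F: "closed F" "convex F" "F \<noteq> {}"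
  shows "F - rel_interior F \<in> null_sets (affine_lebesgue (affine hull F))"
proof -
  have ne: "affine hull F \<noteq> {}" using F(3) by simp
  obtain a B where B: "finite B" "pairwise orthogonal B" "\<And>b. b \<in> B \<Longrightarrow> norm b = 1"
    and L: "affine hull F = (\<lambda>f. a + (\<Sum>b\<in>B. f b *\<^sub>R b)) ` UNIV"
    and leb: "affine_lebesgue (affine hull F) =
      completion (distr (\<Pi>\<^sub>M b\<in>B. lborel) borel (\<lambda>f. a + (\<Sum>b\<in>B. f b *\<^sub>R b)))"
    by (rule affine_lebesgue_parametrization[OF affine_affine_hull ne], rule that) auto
  interpret product_sigma_finite "\<lambda>b :: 'a. lborel :: real measure" ..
  define N where "N = (\<Pi>\<^sub>M b\<in>B. lborel :: real measure)"
  define \<phi> where "\<phi> f = a + (\<Sum>b\<in>B. f b *\<^sub>R b)" for f :: "'a \<Rightarrow> real"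
  define \<mu> where "\<mu> = distr N borel \<phi>"
  have \<phi>[measurable]: "\<phi> \<in> borel_measurable N" unfolding \<phi>_def N_def by measurable
  have em: "emeasure \<mu> A = emeasure N (\<phi> -` A \<inter> space N)" if "A \<in> sets borel" for A
    unfolding \<mu>_def using that \<phi> by (simp add: emeasure_distr)
  have "rel_interior F \<noteq> {}" using rel_interior_eq_empty[OF F(2)] F(3) by simp
  then obtain p where p: "p \<in> rel_interior F" by blast
  then have "p \<in> affine hull F" by (metis hull_inc rel_interior_subset subsetD)
  then obtain f0 where f0: "p = \<phi> f0" unfolding L \<phi>_def by (rule imageE)
  have diff: "\<phi> f - \<phi> g = (\<Sum>b\<in>B. (f b - g b) *\<^sub>R b)" for f g
    by (simp add: \<phi>_def scaleR_diff_left sum_subtractf)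
  have coord: "\<bar>f b - f0 b\<bar> \<le> norm (\<phi> f - p)" if "b \<in> B" for f b
  proof -
    have "(\<phi> f - p) \<bullet> b = (\<Sum>b'\<in>B. if b' = b then f b - f0 b else 0)"
      unfolding f0 diff inner_sum_left
    proof (intro sum.cong refl)
      fix b' assume "b' \<in> B"
      then show "(f b' - f0 b') *\<^sub>R b' \<bullet> b = (if b' = b then f b - f0 b else 0)"
        using B(2) B(3)[OF that] that
        by (auto simp: pairwise_def orthogonal_def dot_square_norm)
    qed
    then have "(\<phi> f - p) \<bullet> b = f b - f0 b" using B(1) that by simp
    then show ?thesis using Cauchy_Schwarz_ineq2[of "\<phi> f - p" b] B(3)[OF that] by simp
  qed
  have finite_ball: "emeasure \<mu> (cball p \<rho>) < \<infinity>" for \<rho>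
  proof -
    have "\<phi> -` cball p \<rho> \<inter> space N \<subseteq> (\<Pi>\<^sub>E b\<in>B. {f0 b - \<rho>..f0 b + \<rho>})"
    proof
      fix f assume f: "f \<in> \<phi> -` cball p \<rho> \<inter> space N"
      have "f b \<in> {f0 b - \<rho>..f0 b + \<rho>}" if "b \<in> B" for b
        using coord[OF that, of f] f by (auto simp: dist_norm norm_minus_commute)
      then show "f \<in> (\<Pi>\<^sub>E b\<in>B. {f0 b - \<rho>..f0 b + \<rho>})"
        using f by (auto simp: N_def space_PiM PiE_iff)
    qed
    then have "emeasure N (\<phi> -` cball p \<rho> \<inter> space N)
        \<le> emeasure N (\<Pi>\<^sub>E b\<in>B. {f0 b - \<rho>..f0 b + \<rho>})"
      unfolding N_def using B(1) by (intro emeasure_mono sets_PiM_I_finite) auto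
    also have "\<dots> = (\<Prod>b\<in>B. emeasure lborel {f0 b - \<rho>..f0 b + \<rho>})"
      unfolding N_def using B(1) by (intro emeasure_PiM) auto
    also have "\<dots> < \<infinity>"
      by (simp add: ennreal_prod_eq_top less_top[symmetric] emeasure_lborel_Icc_eq)
    finally show ?thesis by (simp add: em)
  qed
  have hom: "emeasure \<mu> ((\<lambda>x. p + t *\<^sub>R (x - p)) ` A) = ennreal (t ^ card B) * emeasure \<mu> A"
    if "0 < t" "compact A" for t A
  proof -
    define A' where "A' = (\<lambda>x. p + t *\<^sub>R (x - p)) ` A"
    have "compact A'" unfolding A'_def by (intro compact_continuous_image that continuous_intros)
    then have A': "A' \<in> sets borel" by (rule borel_compact)
    define \<sigma> where "\<sigma> = (\<lambda>f. \<lambda>b\<in>B. f0 b + t * (f b - f0 b))"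
    have \<phi>\<sigma>: "\<phi> (\<sigma> f) = p + t *\<^sub>R (\<phi> f - p)" for f
    proof -
      have "\<phi> (\<sigma> f) - p = t *\<^sub>R (\<phi> f - p)"
        unfolding f0 diff by (simp add: \<sigma>_def scaleR_sum_right)
      then show ?thesis by (simp add: algebra_simps)
    qed
    have inA: "p + t *\<^sub>R (x - p) \<in> A' \<longleftrightarrow> x \<in> A" for x
      using \<open>0 < t\<close> by (auto simp: A'_def)
    have S: "\<phi> -` A' \<inter> space N \<in> sets N" using A' by measurable
    have meas: "\<sigma> \<in> measurable N N"
      using product_lborel_homothety(1)[OF B(1) that(1) S[unfolded N_def]]
      by (simp add: \<sigma>_def N_def)
    have "emeasure N (\<phi> -` A' \<inter> space N)
        = ennreal (t ^ card B) * emeasure N (\<sigma> -` (\<phi> -` A' \<inter> space N) \<inter> space N)"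
      using product_lborel_homothety(2)[OF B(1) that(1) S[unfolded N_def], of f0]
      by (simp add: \<sigma>_def N_def)
    also have "\<sigma> -` (\<phi> -` A' \<inter> space N) \<inter> space N = \<phi> -` A \<inter> space N"
      using measurable_space[OF meas] by (auto simp: \<phi>\<sigma> inA)
    finally show ?thesis using A' borel_compact[OF that(2)] by (simp add: em A'_def[symmetric])
  qed
  have closed: "closed (F - rel_interior F)"
    using closed_rel_frontier[of F] F(1) by (simp add: rel_frontier_def)
  have inside: "p + t *\<^sub>R (x - p) \<in> rel_interior F" if "x \<in> F" "0 < t" "t < 1" for x t
  proof -
    have "x - (1 - t) *\<^sub>R (x - p) \<in> rel_interior F"
      using that by (intro rel_interior_convex_shrink[OF F(2) p]) auto
    then show ?thesis by (simp add: algebra_simps)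
  qed
  define X where "X n = (F - rel_interior F) \<inter> cball p (real n)" for n
  have "X n \<in> null_sets \<mu>" for n
  proof -
    have "compact (X n)" unfolding X_def using closed by (intro closed_Int_compact) auto
    have "emeasure \<mu> (X n) = 0"
    proof (rule null_of_disjoint_homotheties[OF _ finite_ball hom \<open>compact (X n)\<close>])
      show "sets \<mu> = sets borel" by (simp add: \<mu>_def)
      show "p + t *\<^sub>R (x - p) \<notin> X n" if "x \<in> X n" "0 < t" "t < 1" for x t
        using that inside[of x t] by (simp add: X_def)
    qed (auto simp: X_def)
    then show ?thesis using \<open>compact (X n)\<close> by (auto simp: null_sets_def \<mu>_def borel_compact)
  qed
  then have "(\<Union>n. X n) \<in> null_sets \<mu>" by (rule null_sets_UN)
  moreover have "(\<Union>n. X n) = F - rel_interior F"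
    by (auto simp: X_def intro: real_arch_simple)
  ultimately have "F - rel_interior F \<in> null_sets (completion \<mu>)"
    by (simp add: null_sets_completionI)
  then show ?thesis by (simp add: leb \<mu>_def N_def \<phi>_def[abs_def])
qed

section \<open>Limits of the algorithm\<close>

lemma proj_set_closed_graph:
  assumes "closed Z" "s \<longlonglongrightarrow> s'" "y \<longlonglongrightarrow> y'" "\<And>j. y j \<in> proj_set Z (s j)"
  shows "y' \<in> proj_set Z s'"
proof -
  have "y' \<in> Z"
    using assms(1,3,4) by (auto simp: closed_sequential_limits proj_set_iff)
  moreover have "norm (s' - y') \<le> norm (s' - u)" if "u \<in> Z" for u
  proof (rule LIMSEQ_le)
    show "(\<lambda>j. norm (s j - y j)) \<longlonglongrightarrow> norm (s' - y')" by (intro tendsto_intros assms)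
    show "(\<lambda>j. norm (s j - u)) \<longlonglongrightarrow> norm (s' - u)" by (intro tendsto_intros assms)
    show "\<exists>N. \<forall>j\<ge>N. norm (s j - y j) \<le> norm (s j - u)"
      using assms(4) that by (auto simp: proj_set_iff)
  qed
  ultimately show ?thesis by (simp add: proj_set_iff)
qed

lemma tendsto_matrix_vector [tendsto_intros]:
  "(f \<longlongrightarrow> l) F \<Longrightarrow> ((\<lambda>x. A *v f x) \<longlongrightarrow> A *v l) F" for A :: "real^'n^'m"
  by (rule bounded_linear.tendsto[OF matrix_vector_mul_bounded_linear])

lemma algorithm_limit_fixed_point:
  assumes run: "algorithm_run Z zo M c W \<gamma> s0 z y s"
    and "closed Z" and zo: "M *v zo + c = zo"
    and lim: "z \<longlonglongrightarrow> zs" "y \<longlonglongrightarrow> ys" "s \<longlonglongrightarrow> ss"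
  shows "algorithm_fixed_point Z M c W \<gamma> zs ys ss"
proof (cases "zo \<in> Z")
  case True
  then have "z = (\<lambda>_. zo)" "y = (\<lambda>_. zo)" "s = (\<lambda>_. zo)"
    using run by (auto simp: algorithm_run_def)
  then have "zs = zo" "ys = zo" "ss = zo" using lim by (simp_all add: LIMSEQ_const_iff)
  then show ?thesis using True zo by (simp add: algorithm_fixed_point_def proj_set_iff)
next
  case False
  then have step: "z (Suc j) = M *v s j + c" "y (Suc j) \<in> proj_set Z (s j)"
    "s (Suc j) = s j - \<gamma> *\<^sub>R (W *v (z (Suc j) - y (Suc j)))" for j
    using run by (auto simp: algorithm_run_def)
  note lim' = lim[THEN LIMSEQ_Suc]
  have "(\<lambda>j. M *v s j + c) \<longlonglongrightarrow> M *v ss + c" by (intro tendsto_intros lim)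
  then have "(\<lambda>j. z (Suc j)) \<longlonglongrightarrow> M *v ss + c" by (simp only: step(1))
  then have "zs = M *v ss + c" by (rule LIMSEQ_unique[OF lim'(1)])
  moreover have "ys \<in> proj_set Z ss"
    by (rule proj_set_closed_graph[OF \<open>closed Z\<close> lim(3) lim'(2) step(2)])
  moreover have "(\<lambda>j. s j - \<gamma> *\<^sub>R (W *v (z (Suc j) - y (Suc j)))) \<longlonglongrightarrow> ss - \<gamma> *\<^sub>R (W *v (zs - ys))"
    by (intro tendsto_intros lim lim')
  then have "(\<lambda>j. s (Suc j)) \<longlonglongrightarrow> ss - \<gamma> *\<^sub>R (W *v (zs - ys))"
    by (simp only: step(3))
  then have "ss = ss - \<gamma> *\<^sub>R (W *v (zs - ys))" by (rule LIMSEQ_unique[OF lim'(3)])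
  ultimately show ?thesis by (simp add: algorithm_fixed_point_def)
qed

lemma W_mat_injective:
  assumes "spectral_decomposition M Q \<Lambda>" "W_mat Q \<Lambda> *v x = 0"
  shows "x = 0"
proof -
  have Q: "transpose Q ** Q = mat 1" "Q ** transpose Q = mat 1" and pos: "\<And>i. 0 < \<Lambda> $ i"
    using assms(1) by (auto simp: spectral_decomposition_def)
  define a where "a = transpose Q *v x"
  have "transpose Q *v (W_mat Q \<Lambda> *v x) = diag_mat (W_diag \<Lambda>) *v a"
    by (simp add: W_mat_def a_def matrix_vector_mul_assoc matrix_mul_assoc Q)
  then have "diag_mat (W_diag \<Lambda>) *v a = 0" using assms(2) by (simp only: matrix_vector_mult_0_right)
  then have "W_diag \<Lambda> k * a $ k = 0" for k unfolding diag_mat_vec vec_eq_iff by simp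
  moreover have "W_diag \<Lambda> k \<noteq> 0" for k
    using pos by (cases k) (auto simp: less_imp_neq[symmetric])
  ultimately have "a $ k = 0" for k by (metis mult_eq_0_iff)
  then have "a = 0" by (simp add: vec_eq_iff)
  moreover have "x = Q *v a" by (simp add: a_def matrix_vector_mul_assoc Q)
  ultimately show ?thesis by simp
qed

section \<open>Local convergence at relative interior points\<close>

lemma rel_interior_prolong:
  fixes S :: "'a::euclidean_space set"
  assumes "z \<in> rel_interior S" "x \<in> S"
  obtains t where "t > 0" "z + t *\<^sub>R (z - x) \<in> S"
proof -
  obtain e where "e > 0" and e: "ball z e \<inter> affine hull S \<subseteq> S" and "z \<in> S"
    using assms(1) by (auto simp: mem_rel_interior_ball)
  define n where "n = norm (z - x)"
  define t where "t = e / (2 * (n + 1))"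
  have "0 \<le> n" by (simp add: n_def)
  then have "t > 0" using \<open>e > 0\<close> by (simp add: t_def)
  have "n < 2 * (n + 1)" using \<open>0 \<le> n\<close> by (simp add: distrib_left)
  then have "t * norm (z - x) < t * (2 * (n + 1))"
    unfolding n_def[symmetric] using \<open>t > 0\<close> by (rule mult_strict_left_mono)
  also have "\<dots> = e" using \<open>0 \<le> n\<close> by (simp add: t_def)
  finally have "z + t *\<^sub>R (z - x) \<in> ball z e" using \<open>t > 0\<close> by (simp add: dist_norm)
  moreover have "z + t *\<^sub>R (z - x) \<in> affine hull S"
    using \<open>z \<in> S\<close> assms(2) by (intro mem_affine_3_minus affine_affine_hull hull_inc)
  ultimately show ?thesis using that[OF \<open>t > 0\<close>] e by blast
qed

context affine_quadratic
begin

lemma closed_convex_F_set: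
  assumes "\<xi> \<noteq> 0"
  shows "closed (F_set H h E Z \<xi> z)" "convex (F_set H h E Z \<xi> z)"
proof -
  define A where "A = {s. stationary \<xi> z s}"
  define D where "D = {s. z \<in> Z \<and> (\<forall>u\<in>Z. 2 * ((s - z) \<bullet> (u - z)) \<le> (u - z) \<bullet> (u - z))}"
  have F: "F_set H h E Z \<xi> z = A \<inter> D"
    using F_set_iff[OF assms] by (auto simp: A_def D_def proj_set_iff_inner)
  have "closed A"
    unfolding A_def stationary_def by (intro closed_Collect_eq continuous_intros
        bounded_linear.continuous_on[OF matrix_vector_mul_bounded_linear])
  moreover have D: "D = {s. z \<in> Z} \<inter> (\<Inter>u\<in>Z. {s. 2 * ((s - z) \<bullet> (u - z)) \<le> (u - z) \<bullet> (u - z)})"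
    by (auto simp: D_def)
  have "closed D"
    unfolding D by (intro closed_Int closed_INT ballI closed_Collect_le continuous_intros) auto
  ultimately show "closed (F_set H h E Z \<xi> z)" by (simp add: F closed_Int)
  show "convex (F_set H h E Z \<xi> z)"
  proof (rule convexI)
    fix x y and u v :: real
    assume xy: "x \<in> F_set H h E Z \<xi> z" "y \<in> F_set H h E Z \<xi> z" and uv: "0 \<le> u" "0 \<le> v" "u + v = 1"
    define g where "g s = \<xi> *\<^sub>R (z - s) - h - H *v vbar" for s
    have comb: "a = u *\<^sub>R a + v *\<^sub>R a" for a :: "real^'n"
      using uv by (simp flip: scaleR_add_left)
    have "z = vbar + R *v g x" "z = vbar + R *v g y"
      using xy F by (auto simp: A_def stationary_def g_def)
    then have st: "R *v g x = z - vbar" "R *v g y = z - vbar"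
      by (metis add_diff_cancel_left')+
    have "g (u *\<^sub>R x + v *\<^sub>R y) = u *\<^sub>R g x + v *\<^sub>R g y"
      unfolding g_def by (subst comb[of z], subst comb[of h], subst comb[of "H *v vbar"])
        (simp add: algebra_simps)
    then have "R *v g (u *\<^sub>R x + v *\<^sub>R y) = u *\<^sub>R (z - vbar) + v *\<^sub>R (z - vbar)"
      by (simp add: matrix_vector_right_distrib matrix_vector_mult_scaleR st)
    then have "R *v g (u *\<^sub>R x + v *\<^sub>R y) = z - vbar" using comb by metis
    then have "u *\<^sub>R x + v *\<^sub>R y \<in> A" by (simp add: A_def stationary_def g_def)
    moreover have "u *\<^sub>R x + v *\<^sub>R y \<in> D"
    proof -
      have "2 * ((u *\<^sub>R x + v *\<^sub>R y - z) \<bullet> a) \<le> a \<bullet> a"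
        if "2 * ((x - z) \<bullet> a) \<le> a \<bullet> a" "2 * ((y - z) \<bullet> a) \<le> a \<bullet> a" for a
      proof -
        have "u *\<^sub>R x + v *\<^sub>R y - z = u *\<^sub>R (x - z) + v *\<^sub>R (y - z)"
          by (subst comb[of z]) (simp add: algebra_simps)
        then have "2 * ((u *\<^sub>R x + v *\<^sub>R y - z) \<bullet> a) = u * (2 * ((x - z) \<bullet> a)) + v * (2 * ((y - z) \<bullet> a))"
          by (simp only: inner_add_left inner_scaleR_left) (simp add: distrib_left)
        also have "\<dots> \<le> u * (a \<bullet> a) + v * (a \<bullet> a)"
          using that uv by (intro add_mono mult_left_mono) auto
        also have "\<dots> = a \<bullet> a" using uv by (simp flip: distrib_right)
        finally show ?thesis .
      qed
      then show ?thesis using xy F by (auto simp: D_def)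
    qed
    ultimately show "u *\<^sub>R x + v *\<^sub>R y \<in> F_set H h E Z \<xi> z" by (simp add: F)
  qed
qed

text \<open>Moving \<open>s'\<close> towards \<open>z\<close> by the factor \<open>\<xi>' / \<xi>\<close> keeps the multiplier \<open>\<lambda>\<close> and makes the
  projection inequalities strict.\<close>

lemma F_set_rescale:
  assumes "0 < \<xi>'" "\<xi>' < \<xi>" and s': "s' \<in> F_set H h E Z \<xi>' z"
  defines "s \<equiv> z + (\<xi>' / \<xi>) *\<^sub>R (s' - z)"
  shows "s \<in> F_set H h E Z \<xi> z"
    and "\<And>u. u \<in> Z \<Longrightarrow> u \<noteq> z \<Longrightarrow> 2 * ((s - z) \<bullet> (u - z)) < (u - z) \<bullet> (u - z)"
proof -
  have st: "stationary \<xi>' z s'" and pr: "z \<in> proj_set Z s'"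
    using F_set_iff[of \<xi>'] assms(1) s' by auto
  show strict: "2 * ((s - z) \<bullet> (u - z)) < (u - z) \<bullet> (u - z)" if "u \<in> Z" "u \<noteq> z" for u
  proof -
    define a where "a = 2 * ((s' - z) \<bullet> (u - z))"
    have "a \<le> (u - z) \<bullet> (u - z)" using pr that by (auto simp: proj_set_iff_inner a_def)
    moreover have "0 < (u - z) \<bullet> (u - z)" using that by simp
    moreover have "0 < \<xi>' / \<xi>" "\<xi>' / \<xi> < 1" using assms(1,2) by auto
    ultimately have "\<xi>' / \<xi> * a < (u - z) \<bullet> (u - z)"
    proof (cases "a \<le> 0")
      case True
      then have "\<xi>' / \<xi> * a \<le> 0" using \<open>0 < \<xi>' / \<xi>\<close> by (intro mult_nonneg_nonpos) auto
      then show ?thesis using \<open>0 < (u - z) \<bullet> (u - z)\<close> by linarith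
    next
      case False
      then have "\<xi>' / \<xi> * a < 1 * a" using \<open>\<xi>' / \<xi> < 1\<close> by (intro mult_strict_right_mono) auto
      then show ?thesis using \<open>a \<le> (u - z) \<bullet> (u - z)\<close> by linarith
    qed
    then show ?thesis by (simp add: s_def a_def mult.left_commute)
  qed
  have "z \<in> proj_set Z s"
    unfolding proj_set_iff_inner
  proof (intro conjI ballI)
    show "z \<in> Z" using pr by (simp add: proj_set_iff)
    show "2 * ((s - z) \<bullet> (u - z)) \<le> (u - z) \<bullet> (u - z)" if "u \<in> Z" for u
      using strict[OF that] by (cases "u = z") auto
  qed
  moreover have "\<xi> *\<^sub>R (z - s) = \<xi>' *\<^sub>R (z - s')"
    using assms(1,2) by (simp add: s_def algebra_simps)
  then have "stationary \<xi> z s" using st by (simp add: stationary_def)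
  ultimately show "s \<in> F_set H h E Z \<xi> z" using F_set_iff[of \<xi>] assms(1,2) by simp
qed

text \<open>A relative interior point of \<open>F_set\<close> can be moved away from the rescaled point without
  leaving the set, so linear inequalities that are strict at the rescaled point stay strict,
  and a direction \<open>u - z\<close> of \<open>S\<close> orthogonal to \<open>s - z\<close> is orthogonal to the given relative
  interior normal, hence to all normals.\<close>

lemma rel_interior_F_set_nondegenerate:
  assumes \<xi>: "0 < \<xi>'" "\<xi>' < \<xi>" and s': "s' \<in> F_set H h E Z \<xi>' z"
    and ri: "- (\<xi>' *\<^sub>R (z - s')) \<in> rel_interior (regular_normal_cone Z z)"
    and s: "s \<in> rel_interior (F_set H h E Z \<xi> z)"
  shows "\<And>u. u \<in> Z \<Longrightarrow> u \<noteq> z \<Longrightarrow> 2 * ((s - z) \<bullet> (u - z)) < (u - z) \<bullet> (u - z)"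
    and "\<And>S u. convex S \<Longrightarrow> S \<subseteq> Z \<Longrightarrow> z \<in> S \<Longrightarrow> u \<in> S \<Longrightarrow> (s - z) \<bullet> (u - z) = 0 \<Longrightarrow>
      u - z \<in> (regular_normal_cone Z z)\<^sup>\<bottom>"
proof -
  define q where "q = z + (\<xi>' / \<xi>) *\<^sub>R (s' - z)"
  note q = F_set_rescale[OF \<xi> s', folded q_def]
  obtain t where "t > 0" and t: "s + t *\<^sub>R (s - q) \<in> F_set H h E Z \<xi> z"
    using rel_interior_prolong[OF s q(1)] .
  define p where "p = s + t *\<^sub>R (s - q)"
  have p: "z \<in> proj_set Z p" using t F_set_iff[of \<xi>] \<xi> by (simp add: p_def)
  have comb: "(1 + t) * ((s - z) \<bullet> d) = (p - z) \<bullet> d + t * ((q - z) \<bullet> d)" for d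
    by (simp add: p_def inner_diff_left inner_add_left algebra_simps)
  show "2 * ((s - z) \<bullet> (u - z)) < (u - z) \<bullet> (u - z)" if u: "u \<in> Z" "u \<noteq> z" for u
  proof -
    let ?d = "u - z"
    have "(1 + t) * (2 * ((s - z) \<bullet> ?d)) = 2 * ((p - z) \<bullet> ?d) + t * (2 * ((q - z) \<bullet> ?d))"
      using comb[of ?d] by (simp add: algebra_simps)
    also have "\<dots> < ?d \<bullet> ?d + t * (?d \<bullet> ?d)"
      using p q(2)[OF u] u(1) \<open>t > 0\<close>
      by (intro add_le_less_mono mult_strict_left_mono) (auto simp: proj_set_iff_inner)
    also have "\<dots> = (1 + t) * (?d \<bullet> ?d)" by (simp add: algebra_simps)
    finally show ?thesis using \<open>t > 0\<close> by simp
  qed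
  show "u - z \<in> (regular_normal_cone Z z)\<^sup>\<bottom>"
    if S: "convex S" "S \<subseteq> Z" "z \<in> S" "u \<in> S" and 0: "(s - z) \<bullet> (u - z) = 0" for S u
  proof -
    let ?N = "regular_normal_cone Z z"
    let ?d = "u - z"
    define l where "l = - (\<xi>' *\<^sub>R (z - s'))"
    have N: "x \<bullet> ?d \<le> 0" if "x \<in> ?N" for x
      by (rule regular_normal_cone_convex[OF that S])
    have "z \<in> proj_set Z q" using q(1) F_set_iff[of \<xi>] \<xi> by simp
    then have "(p - z) \<bullet> ?d \<le> 0" "(q - z) \<bullet> ?d \<le> 0"
      using p by (auto intro!: N proj_set_imp_regular_normal)
    moreover have "(p - z) \<bullet> ?d + t * ((q - z) \<bullet> ?d) = 0" using comb[of ?d] 0 by simp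
    ultimately have "t * ((q - z) \<bullet> ?d) = 0"
      using \<open>t > 0\<close> by (smt (verit) mult_nonneg_nonpos)
    then have "l \<bullet> ?d = 0" using \<open>t > 0\<close> \<xi> by (simp add: q_def l_def inner_diff_left)
    have "x \<bullet> ?d = 0" if "x \<in> ?N" for x
    proof -
      obtain \<tau> where \<tau>: "\<tau> > 0" "l + \<tau> *\<^sub>R (l - x) \<in> ?N"
        by (rule rel_interior_prolong[OF ri[folded l_def] \<open>x \<in> ?N\<close>])
      have "0 \<le> \<tau> * (x \<bullet> ?d)"
        using N[OF \<tau>(2)] \<open>l \<bullet> ?d = 0\<close> by (simp add: inner_add_left inner_diff_left)
      then show ?thesis using \<tau>(1) N[OF that] by (simp add: zero_le_mult_iff)
    qed
    then show ?thesis by (simp add: orthogonal_comp_def orthogonal_def)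
  qed
qed

text \<open>Near \<open>sh\<close> the projection is affine with linear part the orthogonal projection onto the
  complement of the normal cone, so the errors \<open>s j - sh\<close> follow the linearised iteration.  The
  normal cone at \<open>zh\<close> is not \<open>{0}\<close>, as otherwise \<open>zh\<close> would be a point of \<open>Z\<close> minimising the
  objective over \<open>E\<close>, which only \<open>z_circ\<close> can be.\<close>

lemma algorithm_locally_converges:
  fixes Q :: "real^('d + 'm::finite)^'n"
  assumes \<P>: "finite \<P>" "\<And>S. S \<in> \<P> \<Longrightarrow> polyhedron S" "Z = \<Union>\<P>"
    and C: "\<And>x. x \<bullet> (H *v x) \<le> C * (x \<bullet> x)" "0 < \<xi>" "C < \<xi>"
    and zo: "z_circ H h V vbar \<notin> Z"
    and \<xi>': "0 < \<xi>'" "\<xi>' < \<xi>" and s': "s' \<in> F_set H h E Z \<xi>' zh"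
    and ri: "- (\<xi>' *\<^sub>R (zh - s')) \<in> rel_interior (regular_normal_cone Z zh)"
    and sh: "sh \<in> rel_interior (F_set H h E Z \<xi> zh)"
    and A3: "regular_normal_cone Z zh = {0} \<or>
          (\<exists>\<epsilon>>0. \<forall>w\<in>(regular_normal_cone Z zh)\<^sup>\<bottom>. norm w \<le> \<epsilon> \<longrightarrow> zh + w \<in> Z)"
    and Q: "spectral_decomposition (M_mat H V \<xi>) Q \<Lambda>" and \<gamma>: "0 < \<gamma>" "\<gamma> < 1"
  defines "M \<equiv> M_mat H V \<xi>" and "c \<equiv> c_vec H h V vbar \<xi>" and "W \<equiv> W_mat Q \<Lambda>"
  obtains \<epsilon> where "\<epsilon> > 0"
    "\<And>s0 z y s. norm (s0 - sh) \<le> \<epsilon> \<Longrightarrow>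
      algorithm_run Z (z_circ H h V vbar) M c W \<gamma> s0 z y s \<Longrightarrow>
      convergent z \<and> convergent y \<and> convergent s"
proof -
  define L where "L = (regular_normal_cone Z zh)\<^sup>\<bottom>"
  define w where "w = sh - zh"
  have shF: "sh \<in> F_set H h E Z \<xi> zh" using sh rel_interior_subset by blast
  then have st: "stationary \<xi> zh sh" and pr: "zh \<in> proj_set Z sh"
    using F_set_iff[of \<xi>] C(2) by auto
  have "zh \<in> Z" using pr by (simp add: proj_set_iff)
  have wN: "w \<in> regular_normal_cone Z zh"
    unfolding w_def by (rule proj_set_imp_regular_normal[OF pr])
  have "regular_normal_cone Z zh \<noteq> {0}"
  proof
    assume "regular_normal_cone Z zh = {0}"
    then have "sh = zh" using wN by (simp add: w_def)
    then have "zh = z_circ H h V vbar" using st stationary_zero_iff by simp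
    then show False using zo \<open>zh \<in> Z\<close> by simp
  qed
  then obtain \<eta> where "\<eta> > 0" and \<eta>: "\<And>l. l \<in> L \<Longrightarrow> norm l \<le> \<eta> \<Longrightarrow> zh + l \<in> Z"
    using A3 by (auto simp: L_def)
  have "subspace L" unfolding L_def by (rule subspace_orthogonal_comp)
  then obtain P where P: "orthogonal_projection P L" by (rule orthogonal_projection_exists)
  then have "linear P" by (simp add: orthogonal_projection_def)
  note nondeg = rel_interior_F_set_nondegenerate[OF \<xi>' s' ri sh, folded w_def]
  have SZ: "convex S" "S \<subseteq> Z" if "S \<in> \<P>" for S
    using that \<P> polyhedron_imp_convex by auto
  obtain r where "r > 0"
    and r: "\<And>s y. norm (s - (zh + w)) < r \<Longrightarrow> y \<in> proj_set Z s \<Longrightarrow> y = zh + P (s - (zh + w))"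
  proof (rule proj_set_locally_affine[OF P \<P> \<open>zh \<in> Z\<close> _ _ _ _ \<open>\<eta> > 0\<close> \<eta>])
    show "w \<bullet> (u - zh) \<le> 0" if "S \<in> \<P>" "zh \<in> S" "u \<in> S" for S u
      using regular_normal_cone_convex[OF wN SZ[OF that(1)]] that by blast
    show "u - zh \<in> L" if "S \<in> \<P>" "zh \<in> S" "u \<in> S" "w \<bullet> (u - zh) = 0" for S u
      unfolding L_def by (rule nondeg(2)[OF SZ[OF that(1)] that(2-4)])
    show "w \<bullet> l = 0" if "l \<in> L" for l
      using that wN by (auto simp: L_def orthogonal_comp_def orthogonal_def)
  qed (use nondeg(1) in auto)
  have r: "y = zh + P (s - sh)" if "norm (s - sh) < r" "y \<in> proj_set Z s" for s y
    using r[of s y] that by (simp add: w_def)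
  obtain \<epsilon> where "\<epsilon> > 0" and \<epsilon>: "\<And>e. norm (e 0) \<le> \<epsilon> \<Longrightarrow>
      (\<And>j. norm (e j) < r \<Longrightarrow> e (Suc j) = e j - \<gamma> *\<^sub>R (W *v (M *v e j - P (e j)))) \<Longrightarrow>
      convergent e \<and> (\<forall>j. norm (e j) < r)"
    unfolding W_def M_def
    using linearised_iteration_converges[OF Q spectral_decomposition_ge_1[OF C Q] P \<gamma> \<open>r > 0\<close>]
    by metis
  have Msh: "M *v sh + c = zh"
    using st M_c_eq_iff_stationary[OF C] by (simp add: M_def c_def)
  have conv: "convergent z \<and> convergent y \<and> convergent s"
    if s0: "norm (s0 - sh) \<le> \<epsilon>"
      and run: "algorithm_run Z (z_circ H h V vbar) M c W \<gamma> s0 z y s" for s0 z y s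
  proof -
    have "s 0 = s0" and step: "z (Suc j) = M *v s j + c" "y (Suc j) \<in> proj_set Z (s j)"
      "s (Suc j) = s j - \<gamma> *\<^sub>R (W *v (z (Suc j) - y (Suc j)))" for j
      using run zo by (auto simp: algorithm_run_def)
    define e where "e j = s j - sh" for j
    have z: "z (Suc j) = zh + M *v e j" for j
      using Msh by (simp add: step(1) e_def matrix_vector_mult_diff_distrib algebra_simps)
    have y: "y (Suc j) = zh + P (e j)" if "norm (e j) < r" for j
      using r[OF _ step(2)] that by (simp add: e_def)
    have "e (Suc j) = e j - \<gamma> *\<^sub>R (W *v (M *v e j - P (e j)))" if "norm (e j) < r" for j
    proof -
      have "z (Suc j) - y (Suc j) = M *v e j - P (e j)" by (simp add: z y[OF that])
      then show ?thesis by (simp add: e_def step(3))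
    qed
    then have e: "convergent e" "\<And>j. norm (e j) < r"
      using \<epsilon>[of e] s0 \<open>s 0 = s0\<close> by (auto simp: e_def)
    then obtain l where l: "e \<longlonglongrightarrow> l" by (auto simp: convergent_def)
    have "(\<lambda>j. zh + M *v e j) \<longlonglongrightarrow> zh + M *v l" by (intro tendsto_intros l)
    then have "(\<lambda>j. z (Suc j)) \<longlonglongrightarrow> zh + M *v l" by (simp only: z)
    then have "z \<longlonglongrightarrow> zh + M *v l" by (simp only: filterlim_sequentially_Suc)
    moreover have "(\<lambda>j. P (e j)) \<longlonglongrightarrow> P l"
      using \<open>linear P\<close> by (intro bounded_linear.tendsto[OF _ l]) (simp add: linear_conv_bounded_linear)
    then have "(\<lambda>j. zh + P (e j)) \<longlonglongrightarrow> zh + P l" by (rule tendsto_add[OF tendsto_const])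
    then have "(\<lambda>j. y (Suc j)) \<longlonglongrightarrow> zh + P l" by (simp only: y[OF e(2)])
    then have "y \<longlonglongrightarrow> zh + P l" by (simp only: filterlim_sequentially_Suc)
    moreover have "(\<lambda>j. e j + sh) \<longlonglongrightarrow> l + sh" by (intro tendsto_intros l)
    then have "s \<longlonglongrightarrow> l + sh" by (simp add: e_def)
    ultimately show ?thesis by (auto simp: convergent_def)
  qed
  show ?thesis by (rule that[OF \<open>\<epsilon> > 0\<close> conv])
qed

end

lemma quadratic_form_bound:
  fixes H :: "real^'n^'n"
  obtains C where "\<And>x. x \<bullet> (H *v x) \<le> C * (x \<bullet> x)"
proof -
  obtain C where C: "\<And>x. norm (H *v x) \<le> norm x * C"
    using bounded_linear.bounded[OF matrix_vector_mul_bounded_linear[of H]] by blast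
  have "x \<bullet> (H *v x) \<le> C * (x \<bullet> x)" for x
  proof -
    have "x \<bullet> (H *v x) \<le> norm x * norm (H *v x)" by (rule norm_cauchy_schwarz)
    also have "\<dots> \<le> norm x * (norm x * C)" by (intro mult_left_mono C) auto
    also have "\<dots> = C * (x \<bullet> x)" by (simp add: dot_square_norm power2_eq_square)
    finally show ?thesis .
  qed
  then show ?thesis by (rule that)
qed

section \<open>The convergence theorem\<close>

theorem theorem4p6:
  fixes H :: "real^'n^'n" and h :: "real^'n"
    and blk :: "'n \<Rightarrow> nat" and N :: nat and mk :: "nat \<Rightarrow> nat"
    and Zc :: "nat \<Rightarrow> nat \<Rightarrow> (real^'n) set"
    and A :: "real^'n^'m" and b :: "real^'m"
    and V :: "real^'d^'n" and vbar :: "real^'n"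
    and Z E :: "(real^'n) set"
  assumes H: "positive_definite H"
    and blocks: "range blk = {1..N}"
    and polyhedra: "\<And>k i. k \<in> {1..N} \<Longrightarrow> i \<in> {1..mk k} \<Longrightarrow>
          polyhedron (Zc k i) \<and> Zc k i \<subseteq> block_space blk k"
    and Z: "Z = product_of_unions blk N mk Zc"
    and dims: "CARD('n) = CARD('d) + CARD('m)"
    and A_rank: "rank A = CARD('m)"
    and V_rank: "rank V = CARD('d)"
    and E: "E = {z. A *v z = b}"
    and E_param: "E = {V *v v + vbar | v. True}"
    and feasible: "E \<inter> Z \<noteq> {}"
    and A1: "\<exists>z l. regular_KKT_point H h E Z z l"
    and A2: "\<And>zs \<xi>b. local_minimum (quad_objective H h) (E \<inter> Z) zs \<Longrightarrow> 0 < \<xi>b \<Longrightarrow>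
          F_set H h E Z \<xi>b zs \<noteq> {} \<Longrightarrow> zs \<notin> F_set H h E Z \<xi>b zs \<Longrightarrow>
          \<exists>\<xi>\<ge>\<xi>b. \<exists>ss\<in>F_set H h E Z \<xi> zs.
            - (\<xi> *\<^sub>R (zs - ss)) \<in> rel_interior (regular_normal_cone Z zs)"
    and A3: "\<And>z. z \<in> Z \<Longrightarrow>
          regular_normal_cone Z z = {0} \<or>
          (\<exists>\<epsilon>>0. \<forall>w\<in>(regular_normal_cone Z z)\<^sup>\<bottom>. norm w \<le> \<epsilon> \<longrightarrow> z + w \<in> Z)"
  shows "\<exists>\<xi>0>0. 1 / min_nonzero_eigenvalue (R_mat H V) < \<xi>0 \<and>
    (\<forall>\<xi>\<ge>\<xi>0. \<forall>\<gamma>\<in>{0<..<1}. \<forall>(Q :: real^('d + 'm)^'n) \<Lambda>.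
      spectral_decomposition (M_mat H V \<xi>) Q \<Lambda> \<longrightarrow>
      (let M = M_mat H V \<xi>; c = c_vec H h V vbar \<xi>; W = W_mat Q \<Lambda>; zo = z_circ H h V vbar in
        (\<forall>zh. local_minimum (quad_objective H h) (E \<inter> Z) zh \<and> F_set H h E Z \<xi> zh \<noteq> {} \<longrightarrow>
          (\<exists>X \<subseteq> F_set H h E Z \<xi> zh.
            X \<in> null_sets (affine_lebesgue (affine hull (F_set H h E Z \<xi> zh))) \<and>
            (\<forall>sh \<in> F_set H h E Z \<xi> zh - X. \<exists>\<epsilon>>0. \<forall>s0. norm (s0 - sh) \<le> \<epsilon> \<longrightarrow>
              (\<forall>z y s. algorithm_run Z zo M c W \<gamma> s0 z y s \<longrightarrow>
                (\<exists>zs ys ss. algorithm_fixed_point Z M c W \<gamma> zs ys ss \<and>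
                  z \<longlonglongrightarrow> zs \<and> y \<longlonglongrightarrow> ys \<and> s \<longlonglongrightarrow> ss))))) \<and>
        (\<forall>s0 z y s zs ys ss.
          algorithm_run Z zo M c W \<gamma> s0 z y s \<and>
          z \<longlonglongrightarrow> zs \<and> y \<longlonglongrightarrow> ys \<and> s \<longlonglongrightarrow> ss \<longrightarrow>
            zs = ys \<and> local_minimum (quad_objective H h) (E \<inter> Z) zs \<and>
            ss \<in> T_op Z M c W ss)))"
proof -
  have injV: "inj ((*v) V)" using V_rank by (simp add: full_rank_injective)
  interpret affine_quadratic H h V vbar E by unfold_locales (fact H injV E_param)+
  obtain \<P> where \<P>: "finite \<P>" "\<And>S. S \<in> \<P> \<Longrightarrow> polyhedron S" "Z = \<Union>\<P>"
    using product_of_unions_eq_Union_polyhedra[of N mk Zc blk] polyhedra Z by metis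
  have "closed Z" using \<P> polyhedron_imp_closed by (metis closed_Union)
  obtain C where C: "\<And>x. x \<bullet> (H *v x) \<le> C * (x \<bullet> x)" by (rule quadratic_form_bound[of H]) blast
  \<comment> \<open>At \<open>zo\<close> the relative interior assumption is vacuous, but if \<open>zo\<close> is feasible, then the
    algorithm stops at once.\<close>
  define zo where "zo = z_circ H h V vbar"
  define G where "G = {zh. local_minimum (quad_objective H h) (E \<inter> Z) zh \<and> zh \<noteq> zo \<and>
    (\<exists>\<xi>>0. F_set H h E Z \<xi> zh \<noteq> {})}"
  have "finite G"
    by (rule finite_subset[OF _ finite_local_minima[OF \<P>(1) polyhedron_imp_convex[OF \<P>(2)] \<P>(3)]])
      (auto simp: G_def)
  have "\<forall>zh\<in>G. \<exists>\<xi>'. 0 < \<xi>' \<and> (\<exists>s'\<in>F_set H h E Z \<xi>' zh.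
      - (\<xi>' *\<^sub>R (zh - s')) \<in> rel_interior (regular_normal_cone Z zh))"
  proof
    fix zh assume "zh \<in> G"
    then obtain \<xi> where zh: "local_minimum (quad_objective H h) (E \<inter> Z) zh" "zh \<noteq> zo"
        "0 < \<xi>" "F_set H h E Z \<xi> zh \<noteq> {}"
      by (auto simp: G_def)
    have "zh \<notin> F_set H h E Z \<xi> zh"
      using F_set_iff[of \<xi>] stationary_zero_iff zh(2,3) by (simp add: zo_def)
    from A2[OF zh(1,3,4) this] show "\<exists>\<xi>'. 0 < \<xi>' \<and> (\<exists>s'\<in>F_set H h E Z \<xi>' zh.
        - (\<xi>' *\<^sub>R (zh - s')) \<in> rel_interior (regular_normal_cone Z zh))"
      using zh(3) by (meson order_less_le_trans)
  qed
  from bchoice[OF this] obtain X where X: "\<And>zh. zh \<in> G \<Longrightarrow> 0 < X zh"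
    "\<And>zh. zh \<in> G \<Longrightarrow> \<exists>s'\<in>F_set H h E Z (X zh) zh.
      - (X zh *\<^sub>R (zh - s')) \<in> rel_interior (regular_normal_cone Z zh)"
    by blast
  \<comment> \<open>Above \<open>C\<close> the matrix \<open>\<xi> *\<^sub>R R - mat 1\<close> is invertible, and above \<open>X zh\<close> the multiplier that the
    relative interior assumption provides at \<open>zh\<close> can be rescaled to \<open>\<xi>\<close>.\<close>
  define B where "B = {0, 1 / min_nonzero_eigenvalue R, C} \<union> X ` G"
  define \<xi>0 where "\<xi>0 = Max B + 1"
  have \<xi>0: "b < \<xi>0" if "b \<in> B" for b
    using Max_ge[of B b] that \<open>finite G\<close> by (simp add: \<xi>0_def B_def)
  show ?thesis
  proof (intro exI[of _ \<xi>0] conjI allI ballI impI)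
    show "0 < \<xi>0" "1 / min_nonzero_eigenvalue R < \<xi>0" by (simp_all add: \<xi>0 B_def)
    fix \<xi> \<gamma> :: real and Q :: "real^('d + 'm)^'n" and \<Lambda>
    assume "\<xi>0 \<le> \<xi>" and "\<gamma> \<in> {0<..<1}" and Q: "spectral_decomposition (M_mat H V \<xi>) Q \<Lambda>"
    then have \<gamma>: "0 < \<gamma>" "\<gamma> < 1" by auto
    have \<xi>: "b < \<xi>" if "b \<in> B" for b using \<xi>0[OF that] \<open>\<xi>0 \<le> \<xi>\<close> by linarith
    then have "0 < \<xi>" "C < \<xi>" by (simp_all add: B_def)
    define M where "M = M_mat H V \<xi>"
    define c where "c = c_vec H h V vbar \<xi>"
    define W where "W = W_mat Q \<Lambda>"
    note M_c = M_c_eq_iff_stationary[OF C \<open>0 < \<xi>\<close> \<open>C < \<xi>\<close>, folded M_def c_def]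
    have fixed: "algorithm_fixed_point Z M c W \<gamma> zs ys ss"
      if "algorithm_run Z zo M c W \<gamma> s0 z y s" "z \<longlonglongrightarrow> zs" "y \<longlonglongrightarrow> ys" "s \<longlonglongrightarrow> ss"
      for s0 z y s zs ys ss
    proof (rule algorithm_limit_fixed_point[OF that(1) \<open>closed Z\<close> _ that(2-4)])
      show "M *v zo + c = zo" using M_c stationary_zero_iff by (simp add: zo_def)
    qed
    have local: "\<exists>\<epsilon>>0. \<forall>s0. norm (s0 - sh) \<le> \<epsilon> \<longrightarrow>
        (\<forall>z y s. algorithm_run Z zo M c W \<gamma> s0 z y s \<longrightarrow>
          (\<exists>zs ys ss. algorithm_fixed_point Z M c W \<gamma> zs ys ss \<and>
            z \<longlonglongrightarrow> zs \<and> y \<longlonglongrightarrow> ys \<and> s \<longlonglongrightarrow> ss))"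
      if zh: "local_minimum (quad_objective H h) (E \<inter> Z) zh"
        and sh: "sh \<in> rel_interior (F_set H h E Z \<xi> zh)" for zh sh
    proof -
      have "\<exists>\<epsilon>>0. \<forall>s0. norm (s0 - sh) \<le> \<epsilon> \<longrightarrow>
          (\<forall>z y s. algorithm_run Z zo M c W \<gamma> s0 z y s \<longrightarrow>
            convergent z \<and> convergent y \<and> convergent s)"
      proof (cases "zo \<in> Z")
        case True
        then show ?thesis
          by (intro exI[of _ 1]) (auto simp: algorithm_run_def convergent_const)
      next
        case False
        have "zh \<in> Z" using zh by (simp add: local_minimum_def)
        then have "zh \<in> G"
          using zh sh False \<open>0 < \<xi>\<close> by (auto simp: G_def rel_interior_empty)
        then obtain s' where s': "s' \<in> F_set H h E Z (X zh) zh"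
            "- (X zh *\<^sub>R (zh - s')) \<in> rel_interior (regular_normal_cone Z zh)"
          using X(2) by blast
        have "X zh < \<xi>" using \<open>zh \<in> G\<close> by (intro \<xi>) (simp add: B_def)
        obtain \<epsilon> where "\<epsilon> > 0" "\<And>s0 z y s. norm (s0 - sh) \<le> \<epsilon> \<Longrightarrow>
            algorithm_run Z zo M c W \<gamma> s0 z y s \<Longrightarrow> convergent z \<and> convergent y \<and> convergent s"
          using algorithm_locally_converges[OF \<P> C \<open>0 < \<xi>\<close> \<open>C < \<xi>\<close> False[unfolded zo_def]
              X(1)[OF \<open>zh \<in> G\<close>] \<open>X zh < \<xi>\<close> s' sh A3[OF \<open>zh \<in> Z\<close>] Q \<gamma>]
          unfolding M_def c_def W_def zo_def by metis
        then show ?thesis by metis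
      qed
      then show ?thesis using fixed unfolding convergent_def by meson
    qed
    have limit: "zs = ys \<and> local_minimum (quad_objective H h) (E \<inter> Z) zs \<and> ss \<in> T_op Z M c W ss"
      if fp: "algorithm_fixed_point Z M c W \<gamma> zs ys ss" for zs ys ss
    proof -
      have zs: "zs = M *v ss + c" and ys: "ys \<in> proj_set Z ss"
        and "ss = ss - \<gamma> *\<^sub>R (W *v (zs - ys))"
        using fp by (auto simp: algorithm_fixed_point_def)
      then have "W *v (zs - ys) = 0" using \<gamma> by simp
      then have "zs = ys" using W_mat_injective[OF Q, of "zs - ys"] by (simp add: W_def)
      moreover have "local_minimum (quad_objective H h) (E \<inter> Z) zs"
        using M_c zs ys \<open>zs = ys\<close>
        by (intro stationary_projection_imp_local_minimum[OF \<P> \<open>0 < \<xi>\<close>]) auto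
      moreover have "ss \<in> T_op Z M c W ss"
        unfolding T_op_def using ys \<open>zs = ys\<close> zs
        by (intro CollectI exI[of _ ys]) simp
      ultimately show ?thesis by simp
    qed
    show "let M = M_mat H V \<xi>; c = c_vec H h V vbar \<xi>; W = W_mat Q \<Lambda>; zo = z_circ H h V vbar in
        (\<forall>zh. local_minimum (quad_objective H h) (E \<inter> Z) zh \<and> F_set H h E Z \<xi> zh \<noteq> {} \<longrightarrow>
          (\<exists>X \<subseteq> F_set H h E Z \<xi> zh.
            X \<in> null_sets (affine_lebesgue (affine hull (F_set H h E Z \<xi> zh))) \<and>
            (\<forall>sh \<in> F_set H h E Z \<xi> zh - X. \<exists>\<epsilon>>0. \<forall>s0. norm (s0 - sh) \<le> \<epsilon> \<longrightarrow>
              (\<forall>z y s. algorithm_run Z zo M c W \<gamma> s0 z y s \<longrightarrow>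
                (\<exists>zs ys ss. algorithm_fixed_point Z M c W \<gamma> zs ys ss \<and>
                  z \<longlonglongrightarrow> zs \<and> y \<longlonglongrightarrow> ys \<and> s \<longlonglongrightarrow> ss))))) \<and>
        (\<forall>s0 z y s zs ys ss.
          algorithm_run Z zo M c W \<gamma> s0 z y s \<and>
          z \<longlonglongrightarrow> zs \<and> y \<longlonglongrightarrow> ys \<and> s \<longlonglongrightarrow> ss \<longrightarrow>
            zs = ys \<and> local_minimum (quad_objective H h) (E \<inter> Z) zs \<and>
            ss \<in> T_op Z M c W ss)"
      unfolding Let_def M_def[symmetric] c_def[symmetric] W_def[symmetric] zo_def[symmetric]
    proof (intro conjI allI impI, elim conjE)
      fix zh assume zh: "local_minimum (quad_objective H h) (E \<inter> Z) zh" "F_set H h E Z \<xi> zh \<noteq> {}"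
      let ?F = "F_set H h E Z \<xi> zh"
      have "?F - rel_interior ?F \<in> null_sets (affine_lebesgue (affine hull ?F))"
        using \<open>0 < \<xi>\<close> zh(2) by (intro convex_rel_frontier_null closed_convex_F_set) auto
      then show "\<exists>X \<subseteq> ?F. X \<in> null_sets (affine_lebesgue (affine hull ?F)) \<and>
            (\<forall>sh \<in> ?F - X. \<exists>\<epsilon>>0. \<forall>s0. norm (s0 - sh) \<le> \<epsilon> \<longrightarrow>
              (\<forall>z y s. algorithm_run Z zo M c W \<gamma> s0 z y s \<longrightarrow>
                (\<exists>zs ys ss. algorithm_fixed_point Z M c W \<gamma> zs ys ss \<and>
                  z \<longlonglongrightarrow> zs \<and> y \<longlonglongrightarrow> ys \<and> s \<longlonglongrightarrow> ss)))"
        using local[OF zh(1)] by (intro exI[of _ "?F - rel_interior ?F"]) simp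
    qed (use fixed limit in metis)+
  qed
qed

end
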